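(* Let $(X,T)$ be a topological dynamical system and let $k\ge 1$ be an integer. Suppose that (H1) for every integer $j\ge 1$, the system $(X,T^j)$ is strictly ergodic (minimal and uniquely ergodic); denote by $\mu$ the unique $T$-invariant Borel probability measure (it has full support); (H2) $E_j(T)=G_j(T)$ for all $0\le j\le k$, meaning: $E_0(T)=G_0(T)$ as sets of complex numbers, and for $1\le j\le k$ every element of $E_j(T)$ coincides $\mu$-a.e. with an element of $G_j(T)$. Then for every continuous function $f\in C(X)$ the following are equivalent: (a) $f\in G_k(T)^\perp$; (b) for every $x\in X$, $$\lim_{N\to\infty}\ \sup_{P\in\mathbb{R}_k[t]}\left|\frac1N\sum_{n=0}^{N-1}e^{2\pi i P(n)}f(T^nx)\right|=0.$$
   Context: A topological dynamical system $(X,T)$ consists of a compact metric space $X$ and a continuous map $T:X\to X$. $C(X)$ denotes the continuous complex-valued functions on $X$, and $\mathbb{R}_k[t]$ the set of real polynomials of degree at most $k$. Measurable quasi-eigenfunctions (relative to $\mu$): $E_0(T)$ is the set of $\lambda\in\mathbb{C}$ such that there is a nonzero $h\in L^2(\mu)$ with $h\circ T=\lambda h$ $\mu$-a.e. (eigenvalues are identified with constant functions); for $k\ge1$, $E_k(T)=\{h\in L^2(\mu): |h|=1\ \mu\text{-a.e.},\ (h\circ T)\overline{h}\in E_{k-1}(T)\}$. Continuous quasi-eigenfunctions: $G_0(T)$ is the set of $\lambda\in\mathbb{C}$ such that there is a nonzero $h\in C(X)$ with $h\circ T=\lambda h$ (identified with constant functions); for $k\ge 1$, $G_k(T)=\{h\in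 C(X): |h(x)|=1\ \forall x,\ (h\circ T)\overline{h}\in G_{k-1}(T)\}$. For a set $A\subset L^2(\mu)$, $A^\perp=\{f\in L^2(\mu): \int f\overline{g}\,d\mu=0\ \text{for all } g\in A\}$. *)

theory Defs
  imports "HOL-Probability.Probability" "HOL-Computational_Algebra.Polynomial"
begin

definition minimal_map :: "('a::topological_space \<Rightarrow> 'a) \<Rightarrow> bool" where
  "minimal_map S \<longleftrightarrow> (\<forall>A. closed A \<and> S ` A \<subseteq> A \<longrightarrow> A = {} \<or> A = UNIV)"

definition invariant_prob :: "('a::topological_space \<Rightarrow> 'a) \<Rightarrow> 'a measure \<Rightarrow> bool" where
  "invariant_prob S M \<longleftrightarrow> sets M = sets borel \<and> prob_space M \<and> distr M M S = M"

definition uniquely_ergodic :: "('a::topological_space \<Rightarrow> 'a) \<Rightarrow> bool" where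
  "uniquely_ergodic S \<longleftrightarrow> (\<exists>!M. invariant_prob S M)"

definition strictly_ergodic :: "('a::topological_space \<Rightarrow> 'a) \<Rightarrow> bool" where
  "strictly_ergodic S \<longleftrightarrow> minimal_map S \<and> uniquely_ergodic S"

definition L2 :: "'a measure \<Rightarrow> ('a \<Rightarrow> complex) set" where
  "L2 M = {h. h \<in> borel_measurable M \<and> integrable M (\<lambda>x. (norm (h x))\<^sup>2)}"

definition E0 :: "'a measure \<Rightarrow> ('a \<Rightarrow> 'a) \<Rightarrow> complex set" where
  "E0 M T = {c. \<exists>h\<in>L2 M. \<not> (AE x in M. h x = 0) \<and> (AE x in M. h (T x) = c * h x)}"

text \<open>Measurable quasi-eigenfunctions: Efun M T 0 is E_0 viewed as (a.e.) constant
  functions, Efun M T k = E_k(T) for k \<ge> 1.\<close>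
fun Efun :: "'a measure \<Rightarrow> ('a \<Rightarrow> 'a) \<Rightarrow> nat \<Rightarrow> ('a \<Rightarrow> complex) set" where
  "Efun M T 0 = {g \<in> L2 M. \<exists>c\<in>E0 M T. AE x in M. g x = c}"
| "Efun M T (Suc k) = {h \<in> L2 M. (AE x in M. norm (h x) = 1) \<and>
      (\<lambda>x. h (T x) * cnj (h x)) \<in> Efun M T k}"

definition G0 :: "('a::topological_space \<Rightarrow> 'a) \<Rightarrow> complex set" where
  "G0 T = {c. \<exists>h. continuous_on UNIV h \<and> h \<noteq> (\<lambda>_. 0) \<and> (\<forall>x. h (T x) = c * h x)}"

fun Gfun :: "('a::topological_space \<Rightarrow> 'a) \<Rightarrow> nat \<Rightarrow> ('a \<Rightarrow> complex) set" where
  "Gfun T 0 = {g. \<exists>c\<in>G0 T. g = (\<lambda>_. c)}"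
| "Gfun T (Suc k) = {h. continuous_on UNIV h \<and> (\<forall>x. norm (h x) = 1) \<and>
      (\<lambda>x. h (T x) * cnj (h x)) \<in> Gfun T k}"

end

theory Submission
  imports Defs
begin

text \<open>For the implication from (b) to (a), an element of \<open>G\<^sub>k\<close> evaluated along an orbit is a polynomial
  phase of degree at most k, so dominated convergence applies.

  For the converse, polynomial phases are unimodular sequences whose multiplicative difference of
  order k + 1 is 1; more generally one considers phase sequences over an orbit of x under a power S
  of T whose l-th difference at time n is \<open>v (S\<^sup>n x)\<close>, where v is a quasi-eigenfunction of order
  k - l, and proves uniform decay of the averages by induction on l. For l = 1 the mean ergodic theorem
  for \<open>h \<mapsto> v (h \<circ> S)\<close> together with unique ergodicity suffices, because fixed vectors are
  quasi-eigenfunctions of order k. For larger l there are two cases. If no power of v is a coboundary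
  \<open>\<phi> \<circ> S / \<phi>\<close>, van der Corput's inequality reduces l without any use of orthogonality. Otherwise,
  passing to a power of S makes the l-th difference a coboundary of some \<open>\<psi>\<close>, continuous by hypothesis;
  then the difference of order l - 1 is \<open>r \<psi>\<close> with a unimodular constant r, and compactness of the circle
  makes the estimates uniform in r. Averages along the sequences are subadditive under shifts, so a
  single good length for each sequence, from a bounded set, gives uniform decay.\<close>

section \<open>Uniformly small averages over families of sequences\<close>

text \<open>A direct van der Corput induction is blocked because it replaces f by the correlation of
  \<open>f \<circ> S ^^ h\<close> with f, which need not stay orthogonal to \<open>Gfun T k\<close>.
  So it is used only where orthogonality plays no part. In the other case f is kept, and one
  difference is traded for one more order of the quasi-eigenfunction: their total stays k. The trade
  forces powers of T: only some power of v is a coboundary, and sampling along multiples of m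
  replaces v by block cocycles, which modulo coboundaries are powers of v. (H1) brings such
  solutions back from \<open>T ^^ M\<close> to T, because functions invariant under
  \<open>T ^^ M\<close> are constant. (H2) enters twice: it replaces a fixed vector by an element of
  \<open>Gfun T k\<close>, and it makes the transfer function of a coboundary continuous. Full
  support, a consequence of minimality, then upgrades an almost everywhere equation to every point,
  as phases over arbitrary orbits demand.\<close>

definition unif0 :: "(nat \<Rightarrow> complex) set \<Rightarrow> bool" where
  "unif0 A \<longleftrightarrow> (\<forall>\<epsilon>>0. \<exists>N0. \<forall>N\<ge>N0. \<forall>a\<in>A. norm (\<Sum>n<N. a n) \<le> \<epsilon> * real N)"

definition shift_closed :: "(nat \<Rightarrow> complex) set \<Rightarrow> bool" where
  "shift_closed A \<longleftrightarrow> (\<forall>a\<in>A. (\<lambda>n. a (Suc n)) \<in> A)"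

lemma shift_closed_add: "shift_closed A \<Longrightarrow> a \<in> A \<Longrightarrow> (\<lambda>n. a (m + n)) \<in> A"
proof (induction m)
  case (Suc m)
  then have "(\<lambda>n. a (m + n)) \<in> A" by blast
  then have "(\<lambda>n. a (m + Suc n)) \<in> A" 
    using Suc.prems(1) unfolding shift_closed_def by (auto dest!: bspec[where x="\<lambda>n. a (m + n)"])
  then show ?case by simp
qed simp

lemma unif0_subset: "unif0 B \<Longrightarrow> A \<subseteq> B \<Longrightarrow> unif0 A"
  unfolding unif0_def by (meson subsetD)

lemma sum_lessThan_split_first:
  fixes a :: "nat \<Rightarrow> 'b::comm_monoid_add"
  assumes "M \<le> N"
  shows "(\<Sum>n<N. a n) = (\<Sum>n<M. a n) + (\<Sum>n<N-M. a (M + n))"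
proof -
  have "(\<Sum>n<M+k. a n) = (\<Sum>n<M. a n) + (\<Sum>n<k. a (M + n))" for k
    by (induction k) (auto simp: add.assoc)
  from this[of "N - M"] show ?thesis using assms by simp
qed

text \<open>Greedy block decomposition: the stopping length may depend on the sequence, as long as it
  is bounded.\<close>

lemma unif0_stopping:
  assumes sh: "shift_closed A" and bd: "\<forall>a\<in>A. \<forall>n. norm (a n) \<le> B"
    and stop: "\<And>\<epsilon>. \<epsilon> > 0 \<Longrightarrow> \<exists>K. \<forall>a\<in>A. \<exists>M\<in>{1..K}. norm (\<Sum>n<M. a n) \<le> \<epsilon> * real M"
  shows "unif0 A"
  unfolding unif0_def
proof (intro allI impI)
  fix \<epsilon> :: real assume e: "\<epsilon> > 0"
  obtain K where K: "\<forall>a\<in>A. \<exists>M\<in>{1..K}. norm (\<Sum>n<M. a n) \<le> (\<epsilon>/2) * real M"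
    using stop[of "\<epsilon>/2"] e by auto
  \<comment> \<open>An empty \<open>A\<close> leaves \<open>B\<close> unconstrained, so a negative
    \<open>B\<close> has to be excluded.\<close>
  define B' where "B' = max B 0"
  have B': "norm (a n) \<le> B'" if "a \<in> A" for a n using bd[rule_format, OF that, of n] unfolding B'_def by simp
  have B0: "B' \<ge> 0" unfolding B'_def by simp
  \<comment> \<open>The additive term pays for the last block, which \<open>N\<close> cuts off;
    being independent of \<open>N\<close>, it is absorbed once \<open>N\<close> is large.\<close>
  have main: "norm (\<Sum>n<N. a n) \<le> (\<epsilon>/2) * real N + B' * real K" if "a \<in> A" for a N
    using that
  proof (induction N arbitrary: a rule: less_induct)
    case (less N)
    obtain M where M: "M \<ge> 1" "M \<le> K" "norm (\<Sum>n<M. a n) \<le> (\<epsilon>/2) * real M"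
      using K less.prems by force
    show ?case
    proof (cases "M \<le> N")
      case True
      have "(\<Sum>n<N. a n) = (\<Sum>n<M. a n) + (\<Sum>n<N-M. a (M + n))"
        by (rule sum_lessThan_split_first[OF True])
      moreover have "norm (\<Sum>n<N-M. a (M + n)) \<le> (\<epsilon>/2) * real (N - M) + B' * real K"
        using less.IH[of "N - M"] shift_closed_add[OF sh less.prems] M True by auto
      ultimately have "norm (\<Sum>n<N. a n) \<le> (\<epsilon>/2) * real M + ((\<epsilon>/2) * real (N - M) + B' * real K)"
        using M norm_triangle_mono by metis
      also have "\<dots> = (\<epsilon>/2) * real N + B' * real K"
        using True by (simp add: of_nat_diff right_diff_distrib)
      finally show ?thesis .
    next
      case False
      have "norm (\<Sum>n<N. a n) \<le> (\<Sum>n<N. B')" by (intro sum_norm_le B' less.prems)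
      also have "\<dots> \<le> B' * real K" using False M B0 by (simp add: mult_left_mono mult.commute)
      finally show ?thesis using e by (smt (verit) mult_nonneg_nonneg of_nat_0_le_iff half_gt_zero)
    qed
  qed
  obtain N0 where N0: "real N0 \<ge> 2 * B' * real K / \<epsilon>" using real_arch_simple by blast
  show "\<exists>N0. \<forall>N\<ge>N0. \<forall>a\<in>A. norm (sum a {..<N}) \<le> \<epsilon> * real N"
  proof (intro exI[of _ N0] allI impI ballI)
    fix N a assume "N \<ge> N0" and a: "a \<in> A"
    then have "real N \<ge> 2 * B' * real K / \<epsilon>" using N0 by linarith
    then have "B' * real K \<le> (\<epsilon>/2) * real N" using e by (simp add: field_simps)
    then show "norm (sum a {..<N}) \<le> \<epsilon> * real N" using main[OF a, of N] by argo
  qed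
qed

lemma unif0D_block:
  assumes "unif0 A" "\<epsilon> > 0"
  obtains M where "M \<ge> 1" "\<And>a. a \<in> A \<Longrightarrow> norm (\<Sum>n<M. a n) \<le> \<epsilon> * real M"
proof -
  obtain N0 where "\<forall>N\<ge>N0. \<forall>a\<in>A. norm (\<Sum>n<N. a n) \<le> \<epsilon> * real N"
    using assms unfolding unif0_def by blast
  then show ?thesis using that[of "max 1 N0"] by auto
qed

section \<open>Van der Corput's inequality for families of sequences\<close>

lemma sum_shift_diff_le:
  fixes a :: "nat \<Rightarrow> complex"
  assumes "\<And>n. norm (a n) \<le> B"
  shows "norm ((\<Sum>n<N. a (n + h)) - (\<Sum>n<N. a n)) \<le> 2 * real h * B"
proof (induction h)
  case (Suc h)
  have "(\<Sum>n<N. a (n + Suc h)) = (\<Sum>n<N. a (n + h)) + a (N + h) - a h"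
    using sum.lessThan_Suc_shift[of "\<lambda>n. a (n + h)" N] sum.lessThan_Suc[of "\<lambda>n. a (n + h)" N]
    by (simp add: algebra_simps)
  then have "norm ((\<Sum>n<N. a (n + Suc h)) - (\<Sum>n<N. a n))
     = norm (((\<Sum>n<N. a (n + h)) - (\<Sum>n<N. a n)) + (a (N + h) - a h))" by (simp only:) (simp add: algebra_simps)
  also have "\<dots> \<le> 2 * real h * B + (B + B)"
    using Suc norm_triangle_ineq4[of "a (N+h)" "a h"] assms[of "N+h"] assms[of h]
    by (intro norm_triangle_mono) auto
  finally show ?case by (simp add: algebra_simps)
qed simp

text \<open>A shift changes a sum of length \<open>N\<close> only near its two ends, so averaging
  over shifts costs an error independent of \<open>N\<close>. This serves van der Corput's
  inequality and, later, the comparison of Cesaro means.\<close>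

lemma sum_windows_le:
  fixes a :: "nat \<Rightarrow> complex"
  assumes bd: "\<And>n. norm (a n) \<le> B"
  shows "norm ((\<Sum>n<N. \<Sum>h<H. a (n + h)) - of_nat H * (\<Sum>n<N. a n)) \<le> 2 * (real H)\<^sup>2 * B"
proof -
  have B0: "B \<ge> 0" using bd[of 0] norm_ge_zero order_trans by blast
  have "(\<Sum>n<N. \<Sum>h<H. a (n + h)) - of_nat H * (\<Sum>n<N. a n)
     = (\<Sum>h<H. (\<Sum>n<N. a (n + h)) - (\<Sum>n<N. a n))"
    by (subst sum.swap) (simp add: sum_subtractf)
  also have "norm \<dots> \<le> (\<Sum>h<H. 2 * real H * B)"
  proof (intro sum_norm_le)
    fix h assume "h \<in> {..<H}"
    then have "2 * real h * B \<le> 2 * real H * B" using B0 by (intro mult_right_mono) auto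
    then show "norm ((\<Sum>n<N. a (n + h)) - (\<Sum>n<N. a n)) \<le> 2 * real H * B"
      using sum_shift_diff_le[where a=a and N=N and h=h, OF bd] by linarith
  qed
  finally show ?thesis by (simp add: power2_eq_square algebra_simps)
qed

lemma norm_sum_sq_le:
  fixes a :: "nat \<Rightarrow> complex"
  shows "(norm (\<Sum>n<N. a n))\<^sup>2 \<le> real N * (\<Sum>n<N. (norm (a n))\<^sup>2)"
proof -
  have "(norm (\<Sum>n<N. a n))\<^sup>2 \<le> (\<Sum>n<N. norm (a n) * 1)\<^sup>2"
    by (intro power_mono) (auto simp: norm_sum)
  also have "\<dots> \<le> (\<Sum>n<N. (norm (a n))\<^sup>2) * (\<Sum>n<N. 1\<^sup>2)"
    by (rule Cauchy_Schwarz_ineq_sum)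
  finally show ?thesis by (simp add: mult.commute)
qed

lemma norm_sum_sq_expand:
  fixes a :: "nat \<Rightarrow> complex"
  shows "of_real ((norm (\<Sum>h<H. a h))\<^sup>2) = (\<Sum>h<H. \<Sum>g<H. a h * cnj (a g))"
  unfolding complex_norm_square by (simp add: sum_product)

text \<open>For window sums of length \<open>H\<close>, Cauchy-Schwarz and expansion of the square
  leave diagonal terms, a fraction 1/H of all pairs, and correlations at lags below
  \<open>H\<close>. Shift closure lets the estimate at lag h - g serve every pair with that
  difference.\<close>

lemma unif0_van_der_Corput:
  assumes sh: "shift_closed A" and bd: "\<forall>a\<in>A. \<forall>n. norm (a n) \<le> B"
    and corr: "\<And>h. h \<ge> 1 \<Longrightarrow> unif0 ((\<lambda>a n. a (n + h) * cnj (a n)) ` A)"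
  shows "unif0 A"
proof (rule unif0_stopping[OF sh bd])
  fix \<epsilon> :: real assume e: "\<epsilon> > 0"
  define C where "C = max B 1"
  have C: "norm (a n) \<le> C" if "a \<in> A" for a n using bd[rule_format, OF that, of n] unfolding C_def by simp
  have C1: "C \<ge> 1" unfolding C_def by simp
  \<comment> \<open>Diagonal and off-diagonal terms will contribute 2 \<delta> = \<epsilon>^2/8 in
    total, below (\<epsilon>/2)^2; the other half of \<epsilon> is kept for the window
    error.\<close>
  define \<delta> where "\<delta> = \<epsilon>\<^sup>2 / 16"
  have d: "\<delta> > 0" using e unfolding \<delta>_def by simp
  obtain H where H: "real H > C\<^sup>2 / \<delta>" using reals_Archimedean2 by blast
  have H0: "H > 0" using H C1 d by (metis divide_nonneg_pos gr0I not_less of_nat_0 zero_le_power2)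
  have "\<exists>N0. h \<ge> 1 \<longrightarrow> (\<forall>N\<ge>N0. \<forall>a\<in>A. norm (\<Sum>n<N. a (n + h) * cnj (a n)) \<le> \<delta> * real N)" for h
    using corr[of h] d unfolding unif0_def by (cases "h \<ge> 1") auto
  then obtain N0 where N0: "\<And>h N a. h \<ge> 1 \<Longrightarrow> N \<ge> N0 h \<Longrightarrow> a \<in> A \<Longrightarrow>
      norm (\<Sum>n<N. a (n + h) * cnj (a n)) \<le> \<delta> * real N" by metis
  \<comment> \<open>One \<open>N\<close> must serve the finitely many lags below \<open>H\<close>
    and also make the window error 2 H C at most half of \<epsilon> N.\<close>
  define N where "N = Max (insert 1 (N0 ` {..<H})) + nat \<lceil>4 * real H * C / \<epsilon>\<rceil>"
  have N1: "N \<ge> 1" unfolding N_def by (simp add: trans_le_add1)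
  have NH: "N \<ge> N0 h" if "h < H" for h
    unfolding N_def using that by (intro trans_le_add1 Max_ge) auto
  have "real N \<ge> 4 * real H * C / \<epsilon>" unfolding N_def by linarith
  then have Nbig: "2 * real H * C \<le> (\<epsilon>/2) * real N" using e by (simp add: field_simps)
  show "\<exists>K. \<forall>a\<in>A. \<exists>M\<in>{1..K}. norm (\<Sum>n<M. a n) \<le> \<epsilon> * real M"
  proof (intro exI[of _ N] ballI bexI[of _ N])
    fix a assume a: "a \<in> A"
    have offdiag: "norm (\<Sum>n<N. a (n + h) * cnj (a (n + g))) \<le> \<delta> * real N" if "g < h" "h < H" for g h
    proof -
      have "(\<lambda>n. a (g + n)) \<in> A" by (rule shift_closed_add[OF sh a])
      from N0[of "h - g" N, OF _ _ this] NH[of "h - g"] that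
      have "norm (\<Sum>n<N. a (g + (n + (h - g))) * cnj (a (g + n))) \<le> \<delta> * real N" by auto
      then show ?thesis using that by (simp add: add.commute add.left_commute)
    qed
    have pair: "norm (\<Sum>n<N. a (n + h) * cnj (a (n + g))) \<le> \<delta> * real N + (if g = h then C\<^sup>2 * real N else 0)"
      if "g < H" "h < H" for g h
    proof (cases "g = h")
      case True
      have "norm (\<Sum>n<N. a (n + h) * cnj (a (n + g))) \<le> (\<Sum>n<N. C * C)"
        by (intro sum_norm_le) (auto simp: norm_mult C1 intro!: mult_mono C[OF a] order_trans[OF norm_ge_zero C[OF a]])
      then show ?thesis using True d by (simp add: power2_eq_square mult.commute add_increasing)
    next
      case False
      show ?thesis
      proof (cases "g < h")
        case True then show ?thesis using offdiag[OF True that(2)] False by simp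
      next
        case F: False
        have "(\<Sum>n<N. a (n + h) * cnj (a (n + g))) = cnj (\<Sum>n<N. a (n + g) * cnj (a (n + h)))"
          by (simp add: mult.commute)
        then show ?thesis using offdiag[of h g] F False that by (simp only: complex_mod_cnj) simp
      qed
    qed
    define W where "W n = (\<Sum>h<H. a (n + h))" for n
    have "of_real (\<Sum>n<N. (norm (W n))\<^sup>2) = (\<Sum>n<N. \<Sum>h<H. \<Sum>g<H. a (n + h) * cnj (a (n + g)))"
      unfolding W_def of_real_sum norm_sum_sq_expand ..
    also have "\<dots> = (\<Sum>h<H. \<Sum>g<H. \<Sum>n<N. a (n + h) * cnj (a (n + g)))"
      by (subst sum.swap, rule sum.cong[OF refl], subst sum.swap, rule refl)
    finally have "norm (of_real (\<Sum>n<N. (norm (W n))\<^sup>2) :: complex)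
       \<le> (\<Sum>h<H. \<Sum>g<H. norm (\<Sum>n<N. a (n + h) * cnj (a (n + g))))"
      by (simp only:) (intro order_trans[OF norm_sum] sum_mono norm_sum)
    also have "\<dots> \<le> (\<Sum>h<H. \<Sum>g<H. \<delta> * real N + (if g = h then C\<^sup>2 * real N else 0))"
      by (intro sum_mono pair) auto
    also have "\<dots> = real H * (real H * (\<delta> * real N) + C\<^sup>2 * real N)"
      by (simp add: sum.distrib algebra_simps)
    also have "\<dots> \<le> real H * (real H * (\<delta> * real N) + (real H * \<delta>) * real N)"
      using H d H0 by (intro mult_left_mono add_left_mono mult_right_mono) (auto simp: field_simps)
    also have "\<dots> = 2 * \<delta> * (real H)\<^sup>2 * real N" by (simp add: power2_eq_square)
    finally have S2: "(\<Sum>n<N. (norm (W n))\<^sup>2) \<le> 2 * \<delta> * (real H)\<^sup>2 * real N"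
      by (simp add: norm_of_real sum_nonneg abs_of_nonneg del: of_real_sum)
    have "(norm (\<Sum>n<N. W n))\<^sup>2 \<le> real N * (2 * \<delta> * (real H)\<^sup>2 * real N)"
      using norm_sum_sq_le[of W N] S2 by (smt (verit) mult_left_mono of_nat_0_le_iff)
    also have "\<dots> = \<epsilon>\<^sup>2/8 * (real H)\<^sup>2 * (real N)\<^sup>2" unfolding \<delta>_def by (simp add: power2_eq_square)
    also have "\<dots> \<le> ((\<epsilon>/2) * real H * real N)\<^sup>2"
      by (simp add: power_mult_distrib power_divide mult_right_mono)
    finally have W1: "norm (\<Sum>n<N. W n) \<le> (\<epsilon>/2) * real H * real N"
      using e by (rule_tac power2_le_imp_le) auto
    have "norm (of_nat H * (\<Sum>n<N. a n)) \<le> norm (\<Sum>n<N. W n) + 2 * (real H)\<^sup>2 * C"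
      using sum_windows_le[where a=a and N=N and H=H, OF C[OF a]] unfolding W_def
      by (smt (verit) norm_minus_commute norm_triangle_sub)
    then have "real H * norm (\<Sum>n<N. a n) \<le> real H * ((\<epsilon>/2) * real N + 2 * real H * C)"
      using W1 by (simp add: norm_mult power2_eq_square algebra_simps)
    then have "norm (\<Sum>n<N. a n) \<le> (\<epsilon>/2) * real N + 2 * real H * C"
      using H0 by simp
    then show "norm (\<Sum>n<N. a n) \<le> \<epsilon> * real N" using Nbig by argo
  qed (use N1 in auto)
qed

lemma sum_residue_classes:
  fixes a :: "nat \<Rightarrow> complex"
  shows "(\<Sum>n<M*q. a n) = (\<Sum>s<M. \<Sum>i<q. a (s + M * i))"
proof (induction q)
  case (Suc q)
  have "(\<Sum>n<M * Suc q. a n) = (\<Sum>n<M*q. a n) + (\<Sum>s<M. a (s + M * q))"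
    using sum_lessThan_split_first[of "M*q" "M * Suc q" a] by (simp add: add.commute)
  then show ?case using Suc by (simp add: sum.distrib)
qed simp

text \<open>A block of length M q splits into residue classes mod \<open>M\<close>; the class of s
  is the subsample of the sequence shifted by s, which is again in \<open>A\<close>.\<close>

lemma unif0_subsample:
  assumes sh: "shift_closed A" and bd: "\<forall>a\<in>A. \<forall>n. norm (a n) \<le> B"
    and M: "M \<ge> 1" and u: "unif0 ((\<lambda>a n. a (M * n)) ` A)"
  shows "unif0 A"
proof (rule unif0_stopping[OF sh bd])
  fix \<epsilon> :: real assume "\<epsilon> > 0"
  then obtain q where q: "q \<ge> 1"
    "\<And>b. b \<in> (\<lambda>a n. a (M * n)) ` A \<Longrightarrow> norm (\<Sum>n<q. b n) \<le> \<epsilon> * real q"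
    using unif0D_block[OF u] by blast
  show "\<exists>K. \<forall>a\<in>A. \<exists>M\<in>{1..K}. norm (\<Sum>n<M. a n) \<le> \<epsilon> * real M"
  proof (intro exI[of _ "M*q"] ballI bexI[of _ "M*q"])
    fix a assume a: "a \<in> A"
    have "norm (\<Sum>n<M*q. a n) \<le> (\<Sum>s<M. \<epsilon> * real q)"
      unfolding sum_residue_classes
      using q(2) shift_closed_add[OF sh a] by (intro sum_norm_le) blast
    then show "norm (\<Sum>n<M*q. a n) \<le> \<epsilon> * real (M*q)" by (simp add: algebra_simps)
  qed (use M q in auto)
qed

section \<open>Positive functionals on a compact space\<close>

text \<open>The outer measure below is defined by countable covers with continuous functions instead of
  open sets; this makes subadditivity and the Caratheodory condition for open sets direct.\<close>

locale positive_functional =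
  fixes L :: "('a::metric_space \<Rightarrow> real) \<Rightarrow> real"
  assumes cpt: "compact (UNIV :: 'a set)"
    and L_add: "\<And>g h. continuous_on UNIV g \<Longrightarrow> continuous_on UNIV h \<Longrightarrow> L (\<lambda>x. g x + h x) = L g + L h"
    and L_scale: "\<And>g c. continuous_on UNIV g \<Longrightarrow> L (\<lambda>x. c * g x) = c * L g"
    and L_nonneg: "\<And>g. continuous_on UNIV g \<Longrightarrow> (\<And>x. 0 \<le> g x) \<Longrightarrow> 0 \<le> L g"
    and L_one: "L (\<lambda>_. 1) = 1"
begin

lemma L_zero: "L (\<lambda>_. 0) = 0"
  using L_scale[of "\<lambda>_. 1" 0] by simp

lemma L_diff:
  assumes "continuous_on UNIV g" "continuous_on UNIV h"
  shows "L (\<lambda>x. g x - h x) = L g - L h"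
  using L_add[of "\<lambda>x. g x - h x" h] assms by (simp add: continuous_on_diff)

lemma L_mono:
  assumes "continuous_on UNIV g" "continuous_on UNIV h" "\<And>x. g x \<le> h x"
  shows "L g \<le> L h"
  using L_nonneg[of "\<lambda>x. h x - g x"] L_diff[of h g] assms by (simp add: continuous_on_diff)

lemma L_sum:
  assumes "\<And>i. continuous_on UNIV (g i)"
  shows "L (\<lambda>x. \<Sum>i<(n::nat). g i x) = (\<Sum>i<n. L (g i))"
proof (induction n)
  case (Suc n)
  then show ?case
    using L_add[of "\<lambda>x. \<Sum>i<n. g i x" "g n"] assms by (simp add: continuous_on_sum)
qed (simp add: L_zero)

section \<open>The outer measure of a positive functional\<close>

definition covers :: "'a set \<Rightarrow> (nat \<Rightarrow> 'a \<Rightarrow> real) set" where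
  "covers A = {g. (\<forall>i. continuous_on UNIV (g i)) \<and> (\<forall>i x. 0 \<le> g i x) \<and>
     (\<forall>x\<in>A. 1 \<le> (\<Sum>i. ennreal (g i x)))}"

definition outer :: "'a set \<Rightarrow> ennreal" where
  "outer A = (INF g\<in>covers A. \<Sum>i. ennreal (L (g i)))"

lemma outer_le: "g \<in> covers A \<Longrightarrow> outer A \<le> (\<Sum>i. ennreal (L (g i)))"
  unfolding outer_def by (rule INF_lower)

lemma outer_le_single:
  assumes "continuous_on UNIV h" "\<And>x. 0 \<le> h x" "\<And>x. x \<in> A \<Longrightarrow> 1 \<le> h x"
  shows "outer A \<le> ennreal (L h)"
proof -
  define g where "g i = (if i = 0 then h else (\<lambda>_. 0))" for i :: nat
  have g1: "(\<Sum>i. ennreal (g i x)) = ennreal (h x)" for x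
    by (subst suminf_finite[of "{0}"]) (auto simp: g_def)
  have g2: "(\<Sum>i. ennreal (L (g i))) = ennreal (L h)"
    by (subst suminf_finite[of "{0}"]) (auto simp: g_def L_zero)
  have "g \<in> covers A"
    unfolding covers_def using assms g1 by (auto simp: g_def)
  from outer_le[OF this] show ?thesis by (simp add: g2)
qed

lemma outer_le_1: "outer A \<le> 1"
  using outer_le_single[of "\<lambda>_. 1" A] by (simp add: L_one)

lemma outer_mono: "A \<subseteq> B \<Longrightarrow> outer A \<le> outer B"
  unfolding outer_def by (rule INF_superset_mono) (auto simp: covers_def)

lemma outer_empty: "outer {} = 0"
  using outer_le_single[of "\<lambda>_. 0" "{}"] by (simp add: L_zero)

lemma outer_UN: "outer (\<Union>i. A i) \<le> (\<Sum>i. outer (A i))" for A :: "nat \<Rightarrow> 'a set"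
proof (rule ennreal_le_epsilon)
  fix e :: real assume e: "0 < e"
  have "\<exists>g\<in>covers (A i). (\<Sum>j. ennreal (L (g j))) < outer (A i) + ennreal (e * (1/2)^Suc i)" for i
  proof -
    have "outer (A i) \<noteq> \<top>" using outer_le_1[of "A i"] by (auto simp: top_unique)
    moreover have "0 < ennreal (e * (1/2)^Suc i)" using e by simp
    ultimately have "outer (A i) < outer (A i) + ennreal (e * (1/2)^Suc i)"
      using ennreal_add_left_cancel_less[of "outer (A i)" 0] by simp
    then show ?thesis unfolding outer_def[of "A i"] INF_less_iff by (simp add: outer_def)
  qed
  then obtain g where g: "\<And>i. g i \<in> covers (A i)"
    and gL: "\<And>i. (\<Sum>j. ennreal (L (g i j))) \<le> outer (A i) + ennreal (e * (1/2)^Suc i)"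
    by (metis less_imp_le)
  define G where "G p = g (fst (prod_decode p)) (snd (prod_decode p))" for p
  have "G \<in> covers (\<Union>i. A i)"
    unfolding covers_def
  proof (intro CollectI conjI ballI allI)
    fix x assume "x \<in> (\<Union>i. A i)"
    then obtain i where i: "x \<in> A i" by auto
    have "(1::ennreal) \<le> (\<Sum>j. ennreal (g i j x))" using g[of i] i unfolding covers_def by auto
    also have "\<dots> \<le> (\<Sum>i. \<Sum>j. ennreal (g i j x))"
      using sum_le_suminf[of "\<lambda>i. \<Sum>j. ennreal (g i j x)" "{i}"] by simp
    also have "\<dots> = (\<Sum>p. ennreal (G p x))"
      using suminf_ennreal_2dimen[of "\<lambda>i. \<Sum>j. ennreal (g i j x)" "\<lambda>(i,j). ennreal (g i j x)"]
      by (simp add: G_def split_beta comp_def)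
    finally show "1 \<le> (\<Sum>p. ennreal (G p x))" .
  qed (use g in \<open>auto simp: covers_def G_def\<close>)
  then have "outer (\<Union>i. A i) \<le> (\<Sum>p. ennreal (L (G p)))" by (rule outer_le)
  also have "\<dots> = (\<Sum>i. \<Sum>j. ennreal (L (g i j)))"
    using suminf_ennreal_2dimen[of "\<lambda>i. \<Sum>j. ennreal (L (g i j))" "\<lambda>(i,j). ennreal (L (g i j))"]
    by (simp add: G_def split_beta comp_def)
  also have "\<dots> \<le> (\<Sum>i. outer (A i) + ennreal (e * (1/2)^Suc i))"
    by (intro suminf_le gL) auto
  also have "\<dots> = (\<Sum>i. outer (A i)) + (\<Sum>i. ennreal (e * (1/2)^Suc i))"
    by (subst suminf_add) auto
  also have "(\<Sum>i. ennreal (e * (1/2)^Suc i)) = ennreal e"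
    using sums_mult[OF power_half_series, of e] e by (intro suminf_ennreal_eq) auto
  finally show "outer (\<Union>i. A i) \<le> (\<Sum>i. outer (A i)) + ennreal e" .
qed

lemma outer_measure_space_outer: "outer_measure_space (Pow UNIV) outer"
  unfolding outer_measure_space_def positive_def increasing_def countably_subadditive_def
  using outer_empty outer_mono outer_UN by auto

lemma outer_Un: "outer (A \<union> B) \<le> outer A + outer B"
proof -
  define F where "F i = (if i = 0 then A else if i = 1 then B else {})" for i :: nat
  have "(\<Union>i. F i) = A \<union> B" by (auto simp: F_def split: if_splits)
  moreover have "(\<Sum>i. outer (F i)) = outer A + outer B"
    by (subst suminf_finite[of "{0,1}"]) (auto simp: F_def outer_empty)
  ultimately show ?thesis using outer_UN[of F] by simp
qed

text \<open>The cutoffs \<open>min 1 (n * h)\<close> increase to the indicator of \<open>U\<close>.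
  A single cutoff times a cover of \<open>A\<close> need not cover \<open>A \<inter> U\<close>; the
  increments between successive cutoffs together do, since at each point of \<open>U\<close> they
  telescope to 1. What the m-th cutoff leaves over covers \<open>A - U\<close>, and at every finite
  stage the two costs add up to the cost of the original cover.\<close>

lemma outer_split:
  fixes h :: "'a \<Rightarrow> real"
  assumes h: "continuous_on UNIV h" "\<And>x. 0 \<le> h x"
  defines "U \<equiv> {x. 0 < h x}"
  shows "outer (A \<inter> U) + outer (A - U) \<le> outer A"
  unfolding outer_def[of A]
proof (rule INF_greatest)
  fix g assume g: "g \<in> covers A"
  have gc: "continuous_on UNIV (g i)" and g0: "0 \<le> g i x" for i x using g unfolding covers_def by auto
  define p where "p n x = min 1 (real n * h x)" for n x
  have pc: "continuous_on UNIV (p n)" for n unfolding p_def by (intro continuous_intros h)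
  have p0: "0 \<le> p n x" "p n x \<le> 1" for n x unfolding p_def using h(2)[of x] by auto
  have pm: "p n x \<le> p (Suc n) x" for n x unfolding p_def using h(2)[of x]
    by (intro min.mono mult_right_mono) auto
  have pU: "\<exists>n. p n x = 1" if "x \<in> U" for x
  proof -
    obtain n where "1 \<le> real n * h x"
      using reals_Archimedean3[of "h x"] \<open>x \<in> U\<close> unfolding U_def by (metis less_imp_le mem_Collect_eq)
    then show ?thesis unfolding p_def by (intro exI[of _ n]) simp
  qed
  have pnU: "p n x = 0" if "x \<notin> U" for n x using that h(2)[of x] unfolding U_def p_def by auto
  define D where "D n i x = (p (Suc n) x - p n x) * g i x" for n i x
  have Dc: "continuous_on UNIV (D n i)" for n i unfolding D_def by (intro continuous_intros pc gc)
  have D0: "0 \<le> D n i x" for n i x unfolding D_def using pm g0 by simp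
  define G where "G q = D (fst (prod_decode q)) (snd (prod_decode q))" for q
  define c where "c n = (\<Sum>i. ennreal (L (D n i)))" for n
  have "G \<in> covers (A \<inter> U)"
    unfolding covers_def
  proof (intro CollectI conjI ballI allI)
    fix x assume x: "x \<in> A \<inter> U"
    then obtain m where m: "p m x = 1" using pU by auto
    have "1 \<le> (\<Sum>i. ennreal (g i x))" using g x unfolding covers_def by auto
    have "(\<Sum>n<m. p (Suc n) x - p n x) = 1"
      using m sum_lessThan_telescope[of "\<lambda>n. p n x" m] by (simp add: p_def)
    then have "1 = (\<Sum>n<m. ennreal (p (Suc n) x - p n x))"
      using pm by (simp add: sum_ennreal)
    also have "\<dots> \<le> (\<Sum>n<m. ennreal (p (Suc n) x - p n x) * (\<Sum>i. ennreal (g i x)))"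
      using \<open>1 \<le> (\<Sum>i. ennreal (g i x))\<close> by (intro sum_mono) (metis mult.right_neutral mult_left_mono zero_le)
    also have "\<dots> \<le> (\<Sum>n. ennreal (p (Suc n) x - p n x) * (\<Sum>i. ennreal (g i x)))"
      by (intro sum_le_suminf) auto
    also have "\<dots> = (\<Sum>n. \<Sum>i. ennreal (D n i x))"
      unfolding D_def using pm g0 by (simp add: ennreal_mult)
    also have "\<dots> = (\<Sum>q. ennreal (G q x))"
      using suminf_ennreal_2dimen[of "\<lambda>i. \<Sum>j. ennreal (D i j x)" "\<lambda>(i,j). ennreal (D i j x)"]
      by (simp add: G_def split_beta comp_def)
    finally show "1 \<le> (\<Sum>q. ennreal (G q x))" .
  qed (use Dc D0 in \<open>auto simp: G_def\<close>)
  then have "outer (A \<inter> U) \<le> (\<Sum>q. ennreal (L (G q)))" by (rule outer_le)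
  also have "\<dots> = (\<Sum>n. c n)"
    using suminf_ennreal_2dimen[of "\<lambda>i. \<Sum>j. ennreal (L (D i j))" "\<lambda>(i,j). ennreal (L (D i j))"]
    by (simp add: G_def split_beta comp_def c_def)
  finally have o1: "outer (A \<inter> U) \<le> (\<Sum>n. c n)" .
  have step: "(\<Sum>n<m. c n) + outer (A - U) \<le> (\<Sum>i. ennreal (L (g i)))" for m
  proof -
    have LD: "(\<Sum>n<m. L (D n i)) = L (\<lambda>x. p m x * g i x)" for i
    proof -
      have "(\<Sum>n<m. D n i x) = p m x * g i x" for x
        unfolding D_def sum_distrib_right[symmetric]
        using sum_lessThan_telescope[of "\<lambda>n. p n x" m] by (simp add: p_def)
      then show ?thesis using L_sum[of "\<lambda>n. D n i" m] Dc by simp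
    qed
    have "(\<Sum>n<m. c n) = (\<Sum>i. \<Sum>n<m. ennreal (L (D n i)))"
      unfolding c_def by (rule suminf_sum[symmetric]) auto
    also have "\<dots> = (\<Sum>i. ennreal (L (\<lambda>x. p m x * g i x)))"
      using Dc D0 by (simp add: sum_ennreal L_nonneg LD)
    finally have e1: "(\<Sum>n<m. c n) = (\<Sum>i. ennreal (L (\<lambda>x. p m x * g i x)))" .
    have qc: "continuous_on UNIV (\<lambda>x. (1 - p m x) * g i x)" "continuous_on UNIV (\<lambda>x. p m x * g i x)" for i
      by (intro continuous_intros pc gc)+
    have q0: "0 \<le> (1 - p m x) * g i x" "0 \<le> p m x * g i x" for i x using p0 g0 by simp_all
    have "(\<lambda>i x. (1 - p m x) * g i x) \<in> covers (A - U)"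
      unfolding covers_def using g pnU qc q0 by (auto simp: covers_def)
    then have e2: "outer (A - U) \<le> (\<Sum>i. ennreal (L (\<lambda>x. (1 - p m x) * g i x)))" by (rule outer_le)
    have "ennreal (L (\<lambda>x. p m x * g i x)) + ennreal (L (\<lambda>x. (1 - p m x) * g i x)) = ennreal (L (g i))" for i
    proof -
      have "L (\<lambda>x. p m x * g i x) + L (\<lambda>x. (1 - p m x) * g i x) = L (g i)"
        using L_add[OF qc(2) qc(1), of i i] by (simp add: algebra_simps)
      then show ?thesis using L_nonneg[OF qc(1) q0(1)] L_nonneg[OF qc(2) q0(2)]
        by (simp add: ennreal_plus[symmetric] del: ennreal_plus)
    qed
    then have "(\<Sum>i. ennreal (L (g i))) = (\<Sum>i. ennreal (L (\<lambda>x. p m x * g i x))) + (\<Sum>i. ennreal (L (\<lambda>x. (1 - p m x) * g i x)))"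
      by (subst suminf_add) auto
    then show ?thesis unfolding e1 using e2 by (simp add: add_left_mono)
  qed
  have "(\<Sum>n. c n) + outer (A - U) = (SUP m. (\<Sum>n<m. c n) + outer (A - U))"
    by (simp add: suminf_eq_SUP ennreal_SUP_add_left)
  also have "\<dots> \<le> (\<Sum>i. ennreal (L (g i)))" by (rule SUP_least) (rule step)
  finally show "outer (A \<inter> U) + outer (A - U) \<le> (\<Sum>i. ennreal (L (g i)))"
    using o1 by (meson add_right_mono order_trans)
qed

lemma open_in_lambda_system:
  assumes "open U"
  shows "U \<in> lambda_system UNIV (Pow UNIV) outer"
proof -
  have "\<exists>h. continuous_on UNIV h \<and> (\<forall>x. 0 \<le> h x) \<and> U = {x. 0 < (h x :: real)}"
  \<comment> \<open>\<open>infdist\<close> to the empty set is 0 by convention, so the whole space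
    is treated apart.\<close>
  proof (cases "U = UNIV")
    case True then show ?thesis by (intro exI[of _ "\<lambda>_. 1"]) auto
  next
    case False
    have "x \<in> U \<longleftrightarrow> 0 < infdist x (- U)" for x
      using in_closed_iff_infdist_zero[of "- U" x] assms False infdist_nonneg[of x "- U"] by fastforce
    then show ?thesis
      by (intro exI[of _ "\<lambda>x. infdist x (- U)"]) (auto intro!: continuous_intros simp: infdist_nonneg)
  qed
  then obtain h where h: "continuous_on UNIV h" "\<And>x. 0 \<le> h x" "U = {x. 0 < (h x :: real)}" by auto
  have "outer (U \<inter> A) + outer ((UNIV - U) \<inter> A) = outer A" for A
  proof (rule antisym)
    have "(UNIV - U) \<inter> A = A - U" by auto
    then show "outer (U \<inter> A) + outer ((UNIV - U) \<inter> A) \<le> outer A"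
      using outer_split[OF h(1,2), of A] h(3) by (simp add: Int_commute)
    have "A = U \<inter> A \<union> (UNIV - U) \<inter> A" by auto
    then show "outer A \<le> outer (U \<inter> A) + outer ((UNIV - U) \<inter> A)"
      using outer_Un[of "U \<inter> A" "(UNIV - U) \<inter> A"] by simp
  qed
  then show ?thesis unfolding lambda_system_def by auto
qed

definition rep :: "'a measure" where
  "rep = measure_of UNIV (sets borel) outer"

lemma measure_space_outer: "measure_space UNIV (sets borel) outer"
proof -
  interpret P: sigma_algebra UNIV "Pow UNIV :: 'a set set" by (rule sigma_algebra_Pow)
  have ms: "measure_space UNIV (lambda_system UNIV (Pow UNIV) outer) outer"
    by (rule P.caratheodory_lemma[OF outer_measure_space_outer])
  then have sa: "sigma_algebra UNIV (lambda_system UNIV (Pow UNIV) outer)"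
    unfolding measure_space_def by simp
  have "sets (borel :: 'a measure) = sigma_sets UNIV {S. open S}"
    unfolding borel_def by simp
  also have "\<dots> \<subseteq> lambda_system UNIV (Pow UNIV) outer"
    using open_in_lambda_system by (intro sigma_algebra.sigma_sets_subset[OF sa]) auto
  finally show ?thesis
    using measure_down[OF ms] sets.sigma_algebra_axioms[of "borel :: 'a measure"] by simp
qed

lemma sets_rep: "sets rep = sets borel"
  unfolding rep_def using sets.sigma_sets_eq[of "borel :: 'a measure"] by simp

lemma space_rep: "space rep = UNIV"
  unfolding rep_def by (simp add: space_measure_of_conv)

lemma emeasure_rep: "A \<in> sets borel \<Longrightarrow> emeasure rep A = outer A"
  using measure_space_outer unfolding rep_def measure_space_def
  by (intro emeasure_measure_of) (auto simp: sets_rep[unfolded rep_def])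

text \<open>By compactness finitely many members of a cover already sum to more than 1 - e
  everywhere, and for a finite sum additivity and monotonicity of \<open>L\<close> give the lower
  bound.\<close>

lemma outer_UNIV: "outer UNIV = 1"
proof (rule antisym[OF outer_le_1])
  show "1 \<le> outer UNIV" unfolding outer_def
  proof (rule INF_greatest)
    fix g :: "nat \<Rightarrow> 'a \<Rightarrow> real" assume g: "g \<in> covers UNIV"
    have gc: "continuous_on UNIV (g i)" and g0: "0 \<le> g i x" for i x using g unfolding covers_def by auto
    show "1 \<le> (\<Sum>i. ennreal (L (g i)))"
    proof (rule ennreal_le_epsilon)
      fix e :: real assume e: "0 < e"
      define V where "V n = {x. 1 - e < (\<Sum>i<n. g i x)}" for n
      have opn: "open (V n)" for n unfolding V_def
        by (intro open_Collect_less continuous_intros gc)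
      have "\<exists>n. x \<in> V n" for x
      proof (rule ccontr)
        assume "\<nexists>n. x \<in> V n"
        then have "(\<Sum>i<n. g i x) \<le> 1 - e" for n unfolding V_def by (simp add: not_less)
        then have "(\<Sum>i<n. ennreal (g i x)) \<le> ennreal (1 - e)" for n
          using g0 by (simp add: sum_ennreal ennreal_leI)
        then have "(\<Sum>i. ennreal (g i x)) \<le> ennreal (1 - e)"
          unfolding suminf_eq_SUP by (intro SUP_least) 
        moreover have "1 \<le> (\<Sum>i. ennreal (g i x))" using g unfolding covers_def by auto
        ultimately have "ennreal 1 \<le> ennreal (1 - e)" by (metis ennreal_1 order_trans)
        then show False using e by (simp add: ennreal_le_iff2)
      qed
      then have "UNIV \<subseteq> (\<Union>n. V n)" by auto
      then obtain F where F: "finite F" "UNIV \<subseteq> (\<Union>n\<in>F. V n)"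
        using compactE_image[OF cpt, of UNIV V] opn by (metis subset_UNIV)
      define n where "n = Max (insert 0 F)"
      have "1 - e \<le> (\<Sum>i<n. g i x)" for x
      proof -
        obtain m where "m \<in> F" "x \<in> V m" using F(2) by auto
        then have "m \<le> n" unfolding n_def using F(1) by auto
        then have "(\<Sum>i<m. g i x) \<le> (\<Sum>i<n. g i x)" using g0 by (intro sum_mono2) auto
        then show ?thesis using \<open>x \<in> V m\<close> unfolding V_def by auto
      qed
      then have "L (\<lambda>_. 1 - e) \<le> L (\<lambda>x. \<Sum>i<n. g i x)"
        by (intro L_mono continuous_intros gc) auto
      then have "1 - e \<le> (\<Sum>i<n. L (g i))"
        using L_sum[OF gc] L_scale[of "\<lambda>_. 1" "1 - e"] by (simp add: L_one)
      then have "ennreal 1 \<le> ennreal ((\<Sum>i<n. L (g i)) + e)" by (intro ennreal_leI) simp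
      also have "\<dots> = (\<Sum>i<n. ennreal (L (g i))) + ennreal e"
        using e L_nonneg[OF gc g0] by (simp add: sum_ennreal sum_nonneg)
      also have "\<dots> \<le> (\<Sum>i. ennreal (L (g i))) + ennreal e"
        by (intro add_right_mono sum_le_suminf) auto
      finally show "1 \<le> (\<Sum>i. ennreal (L (g i))) + ennreal e" by simp
    qed
  qed
qed

section \<open>Integration against the constructed measure\<close>

lemma prob_space_rep: "prob_space rep"
  by (rule prob_spaceI) (simp add: space_rep emeasure_rep outer_UNIV)

lemma integrable_rep:
  fixes g :: "'a \<Rightarrow> real"
  assumes "continuous_on UNIV g"
  shows "integrable rep g"
proof -
  interpret prob_space rep by (rule prob_space_rep)
  obtain B where "\<And>x. norm (g x) \<le> B"
    using compact_imp_bounded[OF compact_continuous_image[OF assms cpt]] unfolding bounded_iff by auto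
  then show ?thesis
    using assms sets_rep by (intro integrable_const_bound[of _ B]) (auto cong: measurable_cong_sets intro: borel_measurable_continuous_onI)
qed

text \<open>Cut g into horizontal slices of height \<delta>. Slice j + 1 is at most \<delta> times
  the indicator of the set where slice j is full, and slice j divided by \<delta> covers that set.
  So each slice integrates to at most \<open>L\<close> of the slice below it, and only the bottom
  slice, of integral at most \<delta>, is left unmatched.\<close>

lemma integral_rep_le:
  assumes gc: "continuous_on UNIV g" and g0: "\<And>x. 0 \<le> g x"
  shows "(\<integral>x. g x \<partial>rep) \<le> L g"
proof (rule field_le_epsilon)
  fix \<delta> :: real assume d: "\<delta> > 0"
  interpret prob_space rep by (rule prob_space_rep)
  obtain B where B: "\<And>x. norm (g x) \<le> B"
    using compact_imp_bounded[OF compact_continuous_image[OF gc cpt]] unfolding bounded_iff by auto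
  obtain J :: nat where J: "B / \<delta> \<le> real J" using real_arch_simple by blast
  define s where "s j x = min (max (g x - real j * \<delta>) 0) \<delta>" for j x
  have sc: "continuous_on UNIV (s j)" for j unfolding s_def by (intro continuous_intros gc)
  have s0: "0 \<le> s j x" "s j x \<le> \<delta>" for j x unfolding s_def using d by auto
  have part: "(\<Sum>j<m. s j x) = min (g x) (real m * \<delta>)" for m x
  proof (induction m)
    case 0 then show ?case using g0[of x] by simp
  next
    case (Suc m)
    then show ?case unfolding sum.lessThan_Suc s_def using d by (auto simp: algebra_simps min_def max_def)
  qed
  have full: "(\<Sum>j<Suc J. s j x) = g x" for x
  proof -
    have "g x \<le> real (Suc J) * \<delta>" using B[of x] J d by (simp add: field_simps)
    then show ?thesis unfolding part by simp
  qed
  have step: "(\<integral>x. s (Suc j) x \<partial>rep) \<le> L (s j)" for j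
  proof -
    define K where "K = {x. real (Suc j) * \<delta> \<le> g x}"
    have "closed K" unfolding K_def by (intro closed_Collect_le continuous_intros gc)
    then have Kb: "K \<in> sets borel" by simp
    have "outer K \<le> ennreal (L (\<lambda>x. (1/\<delta>) * s j x))"
    proof (rule outer_le_single)
      show "1 \<le> (1/\<delta>) * s j x" if "x \<in> K" for x
        using that d unfolding K_def s_def by (auto simp: algebra_simps)
    qed (use d s0 in \<open>auto intro!: continuous_intros sc\<close>)
    then have "ennreal (measure rep K) \<le> ennreal (L (\<lambda>x. (1/\<delta>) * s j x))"
      using emeasure_rep[OF Kb] by (simp add: emeasure_eq_measure)
    then have mK: "measure rep K \<le> (1/\<delta>) * L (s j)"
      using L_scale[OF sc, of "1/\<delta>" j] L_nonneg[OF sc s0(1), of j] d by (simp add: ennreal_le_iff)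
    have "s (Suc j) x \<le> \<delta> * indicator K x" for x
      using s0(2)[of "Suc j" x] d unfolding K_def s_def by (auto simp: indicator_def)
    then have "(\<integral>x. s (Suc j) x \<partial>rep) \<le> (\<integral>x. \<delta> * indicator K x \<partial>rep)"
      using Kb sets_rep by (intro integral_mono integrable_rep[OF sc]) (auto simp: emeasure_eq_measure)
    also have "\<dots> = \<delta> * measure rep K" using Kb sets_rep space_rep by simp
    also have "\<dots> \<le> L (s j)" using mK d by (simp add: field_simps)
    finally show ?thesis .
  qed
  have "(\<integral>x. s 0 x \<partial>rep) \<le> (\<integral>x. \<delta> \<partial>rep)"
    using s0 by (intro integral_mono integrable_rep sc) auto
  then have first: "(\<integral>x. s 0 x \<partial>rep) \<le> \<delta>" by (simp add: prob_space)
  have "(\<integral>x. g x \<partial>rep) = (\<integral>x. (\<Sum>j<Suc J. s j x) \<partial>rep)" using full by simp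
  also have "\<dots> = (\<Sum>j<Suc J. (\<integral>x. s j x \<partial>rep))"
    by (rule Bochner_Integration.integral_sum) (rule integrable_rep[OF sc])
  also have "\<dots> = (\<integral>x. s 0 x \<partial>rep) + (\<Sum>j<J. (\<integral>x. s (Suc j) x \<partial>rep))"
    by (rule sum.lessThan_Suc_shift)
  also have "\<dots> \<le> \<delta> + (\<Sum>j<J. L (s j))"
    by (intro add_mono first sum_mono step)
  also have "(\<Sum>j<J. L (s j)) = L (\<lambda>x. \<Sum>j<J. s j x)" by (rule L_sum[OF sc, symmetric])
  also have "\<dots> \<le> L g"
    by (intro L_mono continuous_intros sc gc) (auto simp: part)
  finally show "(\<integral>x. g x \<partial>rep) \<le> L g + \<delta>" by simp
qed

text \<open>The one-sided bound applies to B + g and to B - g; by linearity the second gives the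
  reverse inequality.\<close>

lemma integral_rep:
  assumes gc: "continuous_on UNIV g"
  shows "(\<integral>x. g x \<partial>rep) = L g"
proof -
  interpret prob_space rep by (rule prob_space_rep)
  obtain B where B: "\<And>x. norm (g x) \<le> B"
    using compact_imp_bounded[OF compact_continuous_image[OF gc cpt]] unfolding bounded_iff by auto
  have LB: "L (\<lambda>_. B) = B" using L_scale[of "\<lambda>_. 1" B] by (simp add: L_one)
  have cB: "continuous_on UNIV (\<lambda>x. B + g x)" "continuous_on UNIV (\<lambda>x. B - g x)"
    by (intro continuous_intros gc)+
  have "0 \<le> B + g x" "0 \<le> B - g x" for x using B[of x] by auto
  then have "(\<integral>x. B + g x \<partial>rep) \<le> L (\<lambda>x. B + g x)" "(\<integral>x. B - g x \<partial>rep) \<le> L (\<lambda>x. B - g x)"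
    by (intro integral_rep_le cB; simp)+
  then show ?thesis
    using integrable_rep[OF gc] L_add[of "\<lambda>_. B" g] L_diff[of "\<lambda>_. B" g] gc LB by (simp add: prob_space)
qed

text \<open>Composing a cover of A with S gives a cover of the preimage at the same cost, which
  proves one inequality; complements in a space of total mass 1 give the other.\<close>

lemma invariant_rep:
  assumes S: "continuous_on UNIV S" and inv: "\<And>g. continuous_on UNIV g \<Longrightarrow> L (\<lambda>x. g (S x)) = L g"
  shows "invariant_prob S rep"
proof -
  interpret prob_space rep by (rule prob_space_rep)
  have Sm: "S \<in> borel_measurable borel" using S by (rule borel_measurable_continuous_onI)
  then have Sr: "S \<in> measurable rep rep" using sets_rep by (simp cong: measurable_cong_sets)
  have le: "emeasure rep (S -` A) \<le> emeasure rep A" if A: "A \<in> sets borel" for A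
  proof -
    have SA: "S -` A \<in> sets borel" using measurable_sets[OF Sm A] by simp
    show ?thesis unfolding emeasure_rep[OF A] emeasure_rep[OF SA] outer_def[of A]
    proof (rule INF_greatest)
      fix g assume g: "g \<in> covers A"
      then have "(\<lambda>i x. g i (S x)) \<in> covers (S -` A)"
        unfolding covers_def using continuous_on_compose2[OF _ S] by auto
      from outer_le[OF this] show "outer (S -` A) \<le> (\<Sum>i. ennreal (L (g i)))"
        using inv g unfolding covers_def by simp
    qed
  qed
  have "emeasure rep (S -` A) = emeasure rep A" if A: "A \<in> sets borel" for A
  proof -
    have SA: "S -` A \<in> sets rep" using measurable_sets[OF Sm A] sets_rep by simp
    have Ar: "A \<in> sets rep" using A sets_rep by simp
    have "measure rep (S -` A) \<le> measure rep A" "measure rep (S -` (UNIV - A)) \<le> measure rep (UNIV - A)"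
      using le[OF A] le[of "UNIV - A"] A by (auto simp: emeasure_eq_measure)
    moreover have "measure rep (UNIV - A) = 1 - measure rep A"
      using prob_compl[OF Ar] space_rep by simp
    moreover have "measure rep (S -` (UNIV - A)) = 1 - measure rep (S -` A)"
      using prob_compl[OF SA] space_rep by (simp add: vimage_Diff)
    ultimately show ?thesis by (simp add: emeasure_eq_measure)
  qed
  then have "distr rep rep S = rep"
    using Sr sets_rep space_rep by (intro measure_eqI) (auto simp: emeasure_distr)
  then show ?thesis unfolding invariant_prob_def using sets_rep prob_space_rep by simp
qed

end

section \<open>Uniquely ergodic systems\<close>

text \<open>Tychonoff's theorem in a product of intervals. The index type is arbitrary, later all
  real functions on the space, so a convergent subsequence cannot be expected and the limit is taken
  along a filter.\<close>

lemma cluster_point_filter: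
  fixes A :: "nat \<Rightarrow> 'b \<Rightarrow> real"
  assumes bd: "\<And>i g. \<bar>A i g\<bar> \<le> B g"
  obtains F L where "F \<le> sequentially" "F \<noteq> bot" "\<And>g. ((\<lambda>i. A i g) \<longlongrightarrow> L g) F"
proof -
  define K where "K = PiE UNIV (\<lambda>g. {- B g..B g})"
  have "compactin (product_topology (\<lambda>_. euclidean) UNIV) K"
    unfolding K_def compactin_PiE by simp
  then have "compact K" unfolding euclidean_product_topology by simp
  moreover have "eventually (\<lambda>x. x \<in> K) (filtermap A sequentially)"
    unfolding eventually_filtermap K_def using bd by (auto simp: abs_le_iff minus_le_iff intro!: always_eventually)
  moreover have "filtermap A sequentially \<noteq> bot" by (simp add: filtermap_bot_iff)
  ultimately obtain L where L: "inf (nhds L) (filtermap A sequentially) \<noteq> bot"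
    unfolding compact_filter by blast
  define F where "F = inf sequentially (filtercomap A (nhds L))"
  have "F \<noteq> bot"
  proof
    assume "F = bot"
    then have "eventually (\<lambda>_. False) F" by simp
    then obtain P Q where P: "eventually P sequentially" and Q: "eventually Q (filtercomap A (nhds L))"
      and PQ: "\<And>i. P i \<Longrightarrow> Q i \<Longrightarrow> False" unfolding F_def eventually_inf by blast
    obtain R where R: "eventually R (nhds L)" "\<And>i. R (A i) \<Longrightarrow> Q i"
      using Q unfolding eventually_filtercomap by blast
    have "eventually (\<lambda>y. \<exists>i. P i \<and> y = A i) (filtermap A sequentially)"
      unfolding eventually_filtermap using P by (rule eventually_mono) blast
    then have "eventually (\<lambda>_. False) (inf (nhds L) (filtermap A sequentially))"
      unfolding eventually_inf using R PQ by blast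
    with L show False by (simp add: eventually_False)
  qed
  moreover have "((\<lambda>i. A i g) \<longlongrightarrow> L g) F" for g
  proof -
    have "filterlim A (nhds L) F" unfolding F_def
      by (metis filterlim_filtercomap filterlim_mono inf_le2 order_refl)
    moreover have "((\<lambda>y. y g) \<longlongrightarrow> L g) (nhds L)"
    proof (rule topological_tendstoI)
      fix V :: "real set" assume V: "open V" "L g \<in> V"
      have "open ((\<lambda>y :: 'b \<Rightarrow> real. y g) -` V)"
        using V(1) by (intro open_vimage) auto
      then show "\<forall>\<^sub>F y in nhds L. y g \<in> V"
        unfolding eventually_nhds using V(2) by (intro exI[of _ "(\<lambda>y. y g) -` V"]) auto
    qed
    ultimately show ?thesis by (rule filterlim_compose[rotated])
  qed
  moreover have "F \<le> sequentially" unfolding F_def by simp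
  ultimately show ?thesis using that by blast
qed

lemma funpow_continuous_on:
  fixes S :: "'a::topological_space \<Rightarrow> 'a"
  assumes "continuous_on UNIV S"
  shows "continuous_on UNIV (S ^^ n)"
proof (induction n)
  case (Suc n)
  then show ?case using continuous_on_compose[of UNIV "S ^^ n" S] assms
    by (simp add: continuous_on_subset)
qed (simp add: id_def)

lemma continuous_bounded_on_compact:
  fixes g :: "'a::topological_space \<Rightarrow> 'b::real_normed_vector"
  assumes "compact (UNIV :: 'a set)" "continuous_on UNIV g"
  obtains B where "B \<ge> 0" "\<And>x. norm (g x) \<le> B"
proof -
  obtain B where B: "\<And>x. norm (g x) \<le> B"
    using compact_imp_bounded[OF compact_continuous_image[OF assms(2,1)]] unfolding bounded_iff by auto
  then show ?thesis using that[of B] order_trans[OF norm_ge_zero B] by blast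
qed

locale ue_system =
  fixes S :: "'a::metric_space \<Rightarrow> 'a" and \<mu> :: "'a measure"
  assumes cpt: "compact (UNIV :: 'a set)" and S_cont: "continuous_on UNIV S"
    and inv: "invariant_prob S \<mu>" and ue: "uniquely_ergodic S"
begin

sublocale prob_space \<mu> using inv unfolding invariant_prob_def by simp

lemma sets_mu [simp, measurable_cong]: "sets \<mu> = sets borel"
  using inv unfolding invariant_prob_def by simp

lemma space_mu [simp]: "space \<mu> = UNIV"
  using sets_eq_imp_space_eq[OF sets_mu] by simp

lemma prob_UNIV [simp]: "measure \<mu> UNIV = 1"
  using prob_space by simp

lemma measurable_cont: "continuous_on UNIV g \<Longrightarrow> g \<in> borel_measurable \<mu>"
  using borel_measurable_continuous_onI by (metis measurable_cong_sets sets_mu)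

lemma S_meas [measurable]: "S \<in> measurable \<mu> \<mu>"
  using measurable_cont[OF S_cont] by (metis measurable_cong_sets sets_mu)

lemma Sn_cont: "continuous_on UNIV (S ^^ n)"
  by (rule funpow_continuous_on[OF S_cont])

lemma Sn_meas [measurable]: "S ^^ n \<in> measurable \<mu> \<mu>"
  using measurable_cont[OF Sn_cont] by (metis measurable_cong_sets sets_mu)

lemma comp_Sn_cont: "continuous_on UNIV g \<Longrightarrow> continuous_on UNIV (\<lambda>x. g ((S ^^ n) x))"
  using continuous_on_compose2[OF _ Sn_cont] by auto

lemma integrable_cont:
  fixes g :: "'a \<Rightarrow> 'b::{banach, second_countable_topology}"
  assumes "continuous_on UNIV g"
  shows "integrable \<mu> g"
proof -
  obtain B where "\<And>x. norm (g x) \<le> B" using continuous_bounded_on_compact[OF cpt assms] by blast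
  then show ?thesis using measurable_cont[OF assms] by (intro integrable_const_bound[of _ B]) auto
qed

lemma distr_S: "distr \<mu> \<mu> S = \<mu>" using inv unfolding invariant_prob_def by simp

lemma integral_S:
  fixes g :: "'a \<Rightarrow> 'b::{banach, second_countable_topology}"
  assumes "g \<in> borel_measurable \<mu>"
  shows "(\<integral>x. g (S x) \<partial>\<mu>) = (\<integral>x. g x \<partial>\<mu>)"
  using integral_distr[OF S_meas assms] distr_S by simp

lemma integral_Sn:
  fixes g :: "'a \<Rightarrow> 'b::{banach, second_countable_topology}"
  assumes "g \<in> borel_measurable \<mu>"
  shows "(\<integral>x. g ((S ^^ n) x) \<partial>\<mu>) = (\<integral>x. g x \<partial>\<mu>)"
proof (induction n)
  case (Suc n)
  have "(\<lambda>x. g ((S ^^ n) x)) \<in> borel_measurable \<mu>" using assms by measurable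
  from integral_S[OF this] Suc show ?case by (simp add: funpow_swap1)
qed simp

lemma AE_S: "AE x in \<mu>. P x \<Longrightarrow> AE x in \<mu>. P (S x)"
  by (rule AE_distrD[OF S_meas, of P, unfolded distr_S])

lemma AE_Sn: "AE x in \<mu>. P x \<Longrightarrow> AE x in \<mu>. P ((S ^^ n) x)"
proof (induction n)
  case (Suc n)
  then have "AE x in \<mu>. P ((S ^^ n) x)" by blast
  from AE_S[OF this] show ?case by (simp add: funpow_swap1)
qed simp

text \<open>Normalised to mean 1, h is the density of an invariant probability measure, which by
  unique ergodicity is \<mu>; hence the density is 1 almost everywhere. The lower bound keeps the
  mean positive.\<close>

lemma invariant_real_const:
  fixes h :: "'a \<Rightarrow> real"
  assumes hm: "h \<in> borel_measurable \<mu>" and lo: "\<And>x. 1 \<le> h x" and hi: "\<And>x. h x \<le> B"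
    and hS: "AE x in \<mu>. h (S x) = h x"
  shows "\<exists>c. AE x in \<mu>. h x = c"
proof -
  note [measurable] = hm
  have int: "integrable \<mu> h"
    using lo hi by (intro integrable_const_bound[of _ B]) (auto intro: order_trans[of 0 1] simp: abs_le_iff minus_le_iff order_trans[OF _ lo])
  define c where "c = (\<integral>x. h x \<partial>\<mu>)"
  have "(\<integral>x. 1 \<partial>\<mu>) \<le> c" unfolding c_def by (intro integral_mono int lo) auto
  then have c: "c \<ge> 1" by (simp add: prob_space)
  define \<nu> where "\<nu> = density \<mu> (\<lambda>x. ennreal (h x / c))"
  have nn: "0 \<le> h x / c" for x using lo[of x] c by simp
  have em: "emeasure \<nu> A = ennreal (\<integral>x. h x / c * indicator A x \<partial>\<mu>)" if A: "A \<in> sets borel" for A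
  proof -
    have "emeasure \<nu> A = (\<integral>\<^sup>+x. ennreal (h x / c * indicator A x) \<partial>\<mu>)"
      unfolding \<nu>_def using A by (subst emeasure_density) (auto intro!: nn_integral_cong split: split_indicator)
    also have "\<dots> = ennreal (\<integral>x. h x / c * indicator A x \<partial>\<mu>)"
      using A nn int by (intro nn_integral_eq_integral integrable_mult_indicator[where 'b=real, unfolded real_scaleR_def, simplified mult.commute] AE_I2)
        (auto split: split_indicator intro!: integrable_real_mult_indicator)
    finally show ?thesis .
  qed
  have "prob_space \<nu>"
  proof
    have "emeasure \<nu> UNIV = ennreal (\<integral>x. h x / c \<partial>\<mu>)" using em[of UNIV] by simp
    also have "\<dots> = 1" using c unfolding c_def by simp
    finally show "emeasure \<nu> (space \<nu>) = 1" unfolding \<nu>_def by simp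
  qed
  moreover have "distr \<nu> \<nu> S = \<nu>"
  proof (rule measure_eqI)
    fix A assume "A \<in> sets (distr \<nu> \<nu> S)"
    then have A: "A \<in> sets borel" unfolding \<nu>_def by simp
    have SA: "S -` A \<in> sets borel" using measurable_sets[OF S_meas, of A] A by simp
    have Sn: "S \<in> measurable \<nu> \<nu>" unfolding \<nu>_def by simp
    have "emeasure (distr \<nu> \<nu> S) A = emeasure \<nu> (S -` A)"
      using A Sn by (subst emeasure_distr) (auto simp: \<nu>_def)
    also have "\<dots> = ennreal (\<integral>x. h x / c * indicator (S -` A) x \<partial>\<mu>)" by (rule em[OF SA])
    also have "(\<integral>x. h x / c * indicator (S -` A) x \<partial>\<mu>) = (\<integral>x. h (S x) / c * indicator A (S x) \<partial>\<mu>)"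
    proof (rule integral_cong_AE)
      show "AE x in \<mu>. h x / c * indicator (S -` A) x = h (S x) / c * indicator A (S x)"
        using hS by eventually_elim (auto split: split_indicator)
      show "(\<lambda>x. h (S x) / c * indicator A (S x)) \<in> borel_measurable \<mu>"
        using A hm by (intro measurable_compose[OF S_meas, of "\<lambda>x. h x / c * indicator A x"])
          (auto intro!: borel_measurable_times borel_measurable_divide borel_measurable_indicator)
    qed (use SA hm in \<open>auto intro!: borel_measurable_times borel_measurable_divide borel_measurable_indicator\<close>)
    also have "\<dots> = (\<integral>x. h x / c * indicator A x \<partial>\<mu>)"
      using A hm by (intro integral_S[of "\<lambda>x. h x / c * indicator A x"])
        (auto intro!: borel_measurable_times borel_measurable_divide borel_measurable_indicator)
    also have "ennreal \<dots> = emeasure \<nu> A" by (rule em[OF A, symmetric])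
    finally show "emeasure (distr \<nu> \<nu> S) A = emeasure \<nu> A" .
  qed simp
  ultimately have "invariant_prob S \<nu>" unfolding invariant_prob_def by (simp add: \<nu>_def)
  then have "\<nu> = \<mu>" using ue inv unfolding uniquely_ergodic_def by auto
  then have "density \<mu> (\<lambda>x. ennreal (h x / c)) = density \<mu> (\<lambda>x. 1)"
    unfolding \<nu>_def by (simp add: density_1)
  then have "AE x in \<mu>. ennreal (h x / c) = 1"
    by (subst (asm) density_unique_iff) auto
  then have "AE x in \<mu>. h x = c"
    using c nn by (auto elim!: eventually_mono simp: ennreal_eq_1)
  then show ?thesis by blast
qed

lemma invariant_complex_const:
  fixes h :: "'a \<Rightarrow> complex"
  assumes hm: "h \<in> borel_measurable \<mu>" and hi: "\<And>x. norm (h x) \<le> B"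
    and hS: "AE x in \<mu>. h (S x) = h x"
  shows "\<exists>c. AE x in \<mu>. h x = c"
proof -
  note [measurable] = hm
  have R: "\<bar>Re (h x)\<bar> \<le> B" "\<bar>Im (h x)\<bar> \<le> B" for x
    using hi[of x] abs_Re_le_cmod[of "h x"] abs_Im_le_cmod[of "h x"] by linarith+
  \<comment> \<open>Adding B + 1 moves the range from [-B, B] to [1, 2 B + 1], as required for a
    density.\<close>
  have "\<exists>c. AE x in \<mu>. Re (h x) + (B + 1) = c"
    using hS R(1) by (intro invariant_real_const[where B="2*B+1"]) (auto elim!: eventually_mono simp: abs_le_iff minus_le_iff; smt (verit) R(1))+
  moreover have "\<exists>c. AE x in \<mu>. Im (h x) + (B + 1) = c"
    using hS R(2) by (intro invariant_real_const[where B="2*B+1"]) (auto elim!: eventually_mono simp: abs_le_iff minus_le_iff; smt (verit) R(2))+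
  ultimately obtain c d where "AE x in \<mu>. Re (h x) + (B + 1) = c" "AE x in \<mu>. Im (h x) + (B + 1) = d"
    by blast
  then have "AE x in \<mu>. h x = Complex (c - (B+1)) (d - (B+1))"
    by eventually_elim (auto simp: complex_eq_iff)
  then show ?thesis by blast
qed

text \<open>Failure of uniform convergence would produce, as a cluster point of averages along orbit
  segments, a second invariant probability measure.\<close>

lemma uniform_averages:
  fixes g :: "'a \<Rightarrow> real"
  assumes gc: "continuous_on UNIV g" and e: "\<epsilon> > 0"
  shows "\<exists>N0. \<forall>N\<ge>N0. \<forall>x. \<bar>(\<Sum>n<N. g ((S ^^ n) x)) - real N * (\<integral>x. g x \<partial>\<mu>)\<bar> \<le> \<epsilon> * real N"
proof (rule ccontr)
  assume "\<not> ?thesis"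
  then have "\<forall>i. \<exists>N x. N \<ge> i \<and> \<bar>(\<Sum>n<N. g ((S ^^ n) x)) - real N * (\<integral>x. g x \<partial>\<mu>)\<bar> > \<epsilon> * real N"
    by (auto simp: not_le)
  then obtain N y where Ni: "\<And>i. N i \<ge> i"
    and big: "\<And>i. \<bar>(\<Sum>n<N i. g ((S ^^ n) (y i))) - real (N i) * (\<integral>x. g x \<partial>\<mu>)\<bar> > \<epsilon> * real (N i)"
    by metis
  have Npos: "N i > 0" for i using big[of i] by (cases "N i = 0") auto
  \<comment> \<open>The value 0 off the continuous functions makes the averages bounded at every
    index, as the compactness argument demands.\<close>
  define A where "A i h = (if continuous_on UNIV h then (\<Sum>n<N i. h ((S ^^ n) (y i))) / real (N i) else 0)"
    for i and h :: "'a \<Rightarrow> real"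
  have "\<exists>B. \<forall>i. \<bar>A i h\<bar> \<le> B" for h
  proof (cases "continuous_on UNIV h")
    case True
    obtain B where B: "\<And>x. norm (h x) \<le> B" using continuous_bounded_on_compact[OF cpt True] by blast
    have "\<bar>A i h\<bar> \<le> B" for i
    proof -
      have "\<bar>\<Sum>n<N i. h ((S ^^ n) (y i))\<bar> \<le> (\<Sum>n<N i. B)"
        using B by (intro order_trans[OF sum_abs] sum_mono) auto
      then show ?thesis using Npos[of i] True unfolding A_def by (simp add: field_simps)
    qed
    then show ?thesis by blast
  qed (auto simp: A_def)
  then obtain B where B: "\<And>i h. \<bar>A i h\<bar> \<le> B h" by metis
  obtain F L where F: "F \<le> sequentially" "F \<noteq> bot" and lim: "\<And>h. ((\<lambda>i. A i h) \<longlongrightarrow> L h) F"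
    using cluster_point_filter[of A B, OF B] by blast
  have uniq: "L h = l" if "((\<lambda>i. A i h) \<longlongrightarrow> l) F" for h l
    using tendsto_unique[OF F(2) lim that] .
  interpret P: positive_functional L
  proof
    show "compact (UNIV :: 'a set)" by (rule cpt)
    fix g h :: "'a \<Rightarrow> real" and c :: real
    { assume "continuous_on UNIV g" "continuous_on UNIV h"
      then have "A i (\<lambda>x. g x + h x) = A i g + A i h" for i
        unfolding A_def by (simp add: continuous_on_add sum.distrib add_divide_distrib)
      then show "L (\<lambda>x. g x + h x) = L g + L h"
        by (intro uniq) (simp add: tendsto_add lim) }
    { assume "continuous_on UNIV g"
      then have "A i (\<lambda>x. c * g x) = c * A i g" for i
        unfolding A_def by (simp add: continuous_on_mult_left sum_distrib_left)
      then show "L (\<lambda>x. c * g x) = c * L g"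
        by (intro uniq) (simp add: tendsto_mult_left lim) }
    { assume "continuous_on UNIV g" "\<And>x. 0 \<le> g x"
      then have "0 \<le> A i g" for i unfolding A_def by (simp add: sum_nonneg)
      then show "0 \<le> L g" by (intro tendsto_lowerbound[OF lim _ F(2)]) simp }
    have "A i (\<lambda>_. 1) = 1" for i unfolding A_def using Npos[of i] by simp
    then show "L (\<lambda>_. 1) = 1" by (intro uniq) simp
  qed
  have "L (\<lambda>x. h (S x)) = L h" if hc: "continuous_on UNIV h" for h
  proof (rule uniq)
    obtain B where B: "\<And>x. norm (h x) \<le> B" using continuous_bounded_on_compact[OF cpt hc] by blast
    have hS: "continuous_on UNIV (\<lambda>x. h (S x))" using comp_Sn_cont[OF hc, of 1] by simp
    \<comment> \<open>Moving an orbit segment by one step changes only its end points; as the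
      lengths tend to infinity, the limit functional becomes invariant.\<close>
    have diff: "A i (\<lambda>x. h (S x)) - A i h = (h ((S ^^ N i) (y i)) - h (y i)) / real (N i)" for i
    proof -
      have "(\<Sum>n<N i. h (S ((S ^^ n) (y i)))) - (\<Sum>n<N i. h ((S ^^ n) (y i))) = h ((S ^^ N i) (y i)) - h (y i)"
        using sum_lessThan_telescope[of "\<lambda>n. h ((S ^^ n) (y i))" "N i"] by (simp add: sum_subtractf)
      then show ?thesis unfolding A_def using hc hS by (simp add: diff_divide_distrib[symmetric])
    qed
    have "(\<lambda>i. A i (\<lambda>x. h (S x)) - A i h) \<longlonglongrightarrow> 0"
    proof (rule Lim_null_comparison)
      show "\<forall>\<^sub>F i in sequentially. norm (A i (\<lambda>x. h (S x)) - A i h) \<le> 2 * B / real i"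
      proof (intro eventually_sequentiallyI[of 1])
        fix i :: nat assume i: "1 \<le> i"
        have "norm (h ((S ^^ N i) (y i)) - h (y i)) \<le> 2 * B"
          using norm_triangle_ineq4[of "h ((S ^^ N i) (y i))" "h (y i)"] B[of "(S ^^ N i) (y i)"] B[of "y i"] by linarith
        then have "norm (A i (\<lambda>x. h (S x)) - A i h) \<le> 2 * B / real (N i)"
          unfolding diff by (simp add: divide_right_mono)
        also have "\<dots> \<le> 2 * B / real i"
          using Ni[of i] i order_trans[OF norm_ge_zero B] by (intro divide_left_mono) auto
        finally show "norm (A i (\<lambda>x. h (S x)) - A i h) \<le> 2 * B / real i" .
      qed
      show "(\<lambda>i. 2 * B / real i) \<longlonglongrightarrow> 0" by (rule lim_const_over_n)
    qed
    then have "((\<lambda>i. A i (\<lambda>x. h (S x)) - A i h) \<longlongrightarrow> 0) F" using F(1) by (rule tendsto_mono[rotated])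
    from tendsto_add[OF this lim[of h]] show "((\<lambda>i. A i (\<lambda>x. h (S x))) \<longlongrightarrow> L h) F" by simp
  qed
  then have "invariant_prob S P.rep" by (intro P.invariant_rep S_cont)
  then have "P.rep = \<mu>" using ue inv unfolding uniquely_ergodic_def by auto
  then have Lg: "L g = (\<integral>x. g x \<partial>\<mu>)" using P.integral_rep[OF gc] by simp
  have "\<epsilon> \<le> \<bar>A i g - (\<integral>x. g x \<partial>\<mu>)\<bar>" for i
  proof -
    have "(\<Sum>n<N i. g ((S ^^ n) (y i))) - real (N i) * (\<integral>x. g x \<partial>\<mu>) = real (N i) * (A i g - (\<integral>x. g x \<partial>\<mu>))"
      unfolding A_def using gc Npos[of i] by (simp add: field_simps)
    then have "\<epsilon> * real (N i) < real (N i) * \<bar>A i g - (\<integral>x. g x \<partial>\<mu>)\<bar>"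
      using big[of i] by (simp add: abs_mult)
    then show ?thesis using Npos[of i] by (simp add: mult.commute)
  qed
  moreover have "((\<lambda>i. \<bar>A i g - (\<integral>x. g x \<partial>\<mu>)\<bar>) \<longlongrightarrow> \<bar>L g - (\<integral>x. g x \<partial>\<mu>)\<bar>) F"
    by (intro tendsto_intros lim)
  ultimately have "\<epsilon> \<le> \<bar>L g - (\<integral>x. g x \<partial>\<mu>)\<bar>"
    by (intro tendsto_lowerbound[OF _ _ F(2)]) auto
  then show False using Lg e by simp
qed

end

section \<open>Twisted ergodic averages\<close>

lemma cnj_borel_measurable [measurable]: "cnj \<in> borel_measurable borel"
  by (intro borel_measurable_continuous_onI continuous_intros)

text \<open>The multiplicative cocycle over S generated by v. A phase whose first difference reads v
  along the orbit of x is a constant multiple of it.\<close>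

definition cocyc :: "('a \<Rightarrow> 'a) \<Rightarrow> ('a \<Rightarrow> complex) \<Rightarrow> nat \<Rightarrow> 'a \<Rightarrow> complex" where
  "cocyc S v n x = (\<Prod>i<n. v ((S ^^ i) x))"

lemma cocyc_0 [simp]: "cocyc S v 0 x = 1"
  by (simp add: cocyc_def)

lemma cocyc_Suc: "cocyc S v (Suc n) x = cocyc S v n x * v ((S ^^ n) x)"
  by (simp add: cocyc_def)

lemma cocyc_add: "cocyc S v (n + h) x = cocyc S v n x * cocyc S v h ((S ^^ n) x)"
proof (induction h)
  case (Suc h)
  have "(S ^^ h) ((S ^^ n) x) = (S ^^ (n + h)) x" by (metis add.commute comp_apply funpow_add)
  then show ?case using Suc by (simp add: cocyc_Suc mult.assoc)
qed simp

lemma norm_cocyc: "(\<And>x. norm (v x) = 1) \<Longrightarrow> norm (cocyc S v n x) = 1"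
  by (simp add: cocyc_def prod_norm[symmetric])

lemma square_norm_perturb:
  assumes "norm p \<le> C" "norm q \<le> C" "norm (p - q) \<le> \<eta>"
  shows "(norm p)\<^sup>2 \<le> (norm q)\<^sup>2 + 2 * C * \<eta>"
proof -
  have "(norm p)\<^sup>2 - (norm q)\<^sup>2 = (norm p - norm q) * (norm p + norm q)"
    by (simp add: power2_eq_square algebra_simps)
  also have "\<dots> \<le> \<eta> * (2 * C)"
  proof (rule mult_mono)
    show "norm p - norm q \<le> \<eta>" using norm_triangle_ineq2[of p q] assms by linarith
    show "0 \<le> \<eta>" using norm_ge_zero[of "p - q"] assms by linarith
  qed (use assms in auto)
  finally show ?thesis by (simp add: algebra_simps)
qed

locale twisted_system = ue_system +
  fixes v f :: "'a \<Rightarrow> complex" and B :: real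
  assumes v_cont: "continuous_on UNIV v" and v_norm: "\<And>x. norm (v x) = 1"
    and f_cont: "continuous_on UNIV f" and f_bd: "\<And>x. norm (f x) \<le> B"
begin

text \<open>The N-th Cesaro mean of the operator taking g to \<open>v x * g (S x)\<close>, an
  isometry of L2 because v is unimodular and \<mu> is invariant; its n-th iterate carries the factor
  \<open>cocyc S v n\<close>.\<close>

definition A :: "nat \<Rightarrow> ('a \<Rightarrow> complex) \<Rightarrow> 'a \<Rightarrow> complex" where
  "A N g x = (\<Sum>n<N. cocyc S v n x * g ((S ^^ n) x)) / of_nat N"

abbreviation "b N \<equiv> A N f"

definition I :: "('a \<Rightarrow> complex) \<Rightarrow> real" where
  "I g = (\<integral>x. (norm (g x))\<^sup>2 \<partial>\<mu>)"

lemma B_nonneg: "0 \<le> B"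
  using order_trans[OF norm_ge_zero f_bd] .

lemma cocyc_cont: "continuous_on UNIV (cocyc S v n)"
  unfolding cocyc_def[abs_def] by (intro continuous_on_prod comp_Sn_cont v_cont)

lemma A_cont: "continuous_on UNIV g \<Longrightarrow> continuous_on UNIV (A N g)"
proof -
  assume g: "continuous_on UNIV g"
  have "continuous_on UNIV (\<lambda>x. (1 / of_nat N) * (\<Sum>n<N. cocyc S v n x * g ((S ^^ n) x)))"
    by (intro continuous_on_mult_left continuous_on_sum continuous_on_mult cocyc_cont comp_Sn_cont g)
  then show ?thesis by (simp add: A_def[abs_def])
qed

lemma I_integrable: "continuous_on UNIV g \<Longrightarrow> integrable \<mu> (\<lambda>x. (norm (g x))\<^sup>2)"
  for g :: "'a \<Rightarrow> complex"
  by (intro integrable_cont continuous_intros)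

section \<open>Norms of Cesaro means and the mean ergodic theorem\<close>

lemma A_norm_sq_le:
  assumes "N \<ge> 1"
  shows "(norm (A N g x))\<^sup>2 \<le> (\<Sum>n<N. (norm (g ((S ^^ n) x)))\<^sup>2) / real N"
proof -
  have "(norm (\<Sum>n<N. cocyc S v n x * g ((S ^^ n) x)))\<^sup>2 \<le> real N * (\<Sum>n<N. (norm (g ((S ^^ n) x)))\<^sup>2)"
    using norm_sum_sq_le[of "\<lambda>n. cocyc S v n x * g ((S ^^ n) x)" N]
    by (simp add: norm_mult norm_cocyc[OF v_norm])
  then show ?thesis using assms unfolding A_def
    by (simp add: norm_divide power_divide divide_simps power2_eq_square mult.commute mult.left_commute)
qed

lemma A_contraction:
  assumes N: "N \<ge> 1" and g: "continuous_on UNIV g"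
  shows "I (A N g) \<le> I g"
proof -
  have gi: "integrable \<mu> (\<lambda>x. (norm (g ((S ^^ n) x)))\<^sup>2)" for n
    by (rule I_integrable[OF comp_Sn_cont[OF g]])
  have "I (A N g) \<le> (\<integral>x. (\<Sum>n<N. (norm (g ((S ^^ n) x)))\<^sup>2) / real N \<partial>\<mu>)"
    unfolding I_def using N g gi A_norm_sq_le
    by (intro integral_mono I_integrable[OF A_cont[OF g]] integrable_divide_zero Bochner_Integration.integrable_sum) auto
  also have "\<dots> = (\<Sum>n<N. (\<integral>x. (norm (g ((S ^^ n) x)))\<^sup>2 \<partial>\<mu>)) / real N"
    using gi by simp
  also have "\<dots> = (\<Sum>n<N. I g) / real N"
    unfolding I_def using measurable_cont[OF g]
    by (subst integral_Sn[where g = "\<lambda>x. (norm (g x))\<^sup>2"]) auto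
  also have "\<dots> = I g" using N by simp
  finally show ?thesis .
qed

lemma b_bd: "norm (b N x) \<le> B"
proof (cases "N = 0")
  case True then show ?thesis using B_nonneg by (simp add: A_def)
next
  case False
  have "norm (\<Sum>n<N. cocyc S v n x * f ((S ^^ n) x)) \<le> (\<Sum>n<N. B)"
    by (intro sum_norm_le) (simp add: norm_mult norm_cocyc[OF v_norm] f_bd)
  then show ?thesis using False by (simp add: A_def norm_divide divide_simps mult.commute)
qed

lemma sum_b_window:
  "(\<Sum>h<H. cocyc S v (n + h) x * f ((S ^^ (n + h)) x)) = of_nat H * (cocyc S v n x * b H ((S ^^ n) x))"
proof -
  have "(\<Sum>h<H. cocyc S v (n + h) x * f ((S ^^ (n + h)) x))
    = cocyc S v n x * (\<Sum>h<H. cocyc S v h ((S ^^ n) x) * f ((S ^^ h) ((S ^^ n) x)))"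
    unfolding sum_distrib_left cocyc_add
    by (intro sum.cong refl) (simp add: mult.assoc, metis add.commute comp_apply funpow_add)
  then show ?thesis by (cases "H = 0") (auto simp: A_def)
qed

lemma windows_bound:
  "norm (of_nat H * (\<Sum>n<N. cocyc S v n x * b H ((S ^^ n) x))
      - of_nat H * (\<Sum>n<N. cocyc S v n x * f ((S ^^ n) x))) \<le> 2 * (real H)\<^sup>2 * B"
proof -
  have "norm (cocyc S v n x * f ((S ^^ n) x)) \<le> B" for n
    by (simp add: norm_mult norm_cocyc[OF v_norm] f_bd)
  from sum_windows_le[of "\<lambda>n. cocyc S v n x * f ((S ^^ n) x)", OF this, of H N]
  show ?thesis unfolding sum_b_window sum_distrib_left[symmetric] .
qed

text \<open>Averaging \<open>b H\<close> once more is a window average of the original sequence, so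
  only boundary terms separate it from \<open>b N\<close>. Together with contraction this compares
  the norms of early and late averages.\<close>

lemma A_b_close:
  assumes "N \<ge> 1" "H \<ge> 1"
  shows "norm (A N (b H) x - b N x) \<le> 2 * real H * B / real N"
proof -
  have "of_nat H * of_nat N * (A N (b H) x - b N x) = of_nat H * (\<Sum>n<N. cocyc S v n x * b H ((S ^^ n) x))
      - of_nat H * (\<Sum>n<N. cocyc S v n x * f ((S ^^ n) x))"
    unfolding A_def[of N] using assms by (simp add: field_simps)
  then have "norm (of_nat H * of_nat N * (A N (b H) x - b N x)) \<le> 2 * (real H)\<^sup>2 * B"
    using windows_bound[where H=H and N=N and x=x] by (simp only:)
  then have "real H * real N * norm (A N (b H) x - b N x) \<le> 2 * (real H)\<^sup>2 * B"
    by (simp add: norm_mult)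
  then have "real H * (real N * norm (A N (b H) x - b N x)) \<le> real H * (2 * real H * B)"
    by (simp add: power2_eq_square mult.assoc mult.left_commute)
  then have "real N * norm (A N (b H) x - b N x) \<le> 2 * real H * B" using assms by simp
  then show ?thesis using assms by (simp add: field_simps)
qed

lemma I_perturb:
  assumes "continuous_on UNIV p" "continuous_on UNIV q"
    and "\<And>x. norm (p x) \<le> C" "\<And>x. norm (q x) \<le> C" "\<And>x. norm (p x - q x) \<le> \<eta>"
  shows "I p \<le> I q + 2 * C * \<eta>"
proof -
  have "I p \<le> (\<integral>x. (norm (q x))\<^sup>2 + 2 * C * \<eta> \<partial>\<mu>)"
    unfolding I_def using assms
    by (intro integral_mono I_integrable Bochner_Integration.integrable_add square_norm_perturb) auto
  also have "\<dots> = I q + 2 * C * \<eta>"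
    unfolding I_def using I_integrable[OF assms(2)] by simp
  finally show ?thesis .
qed

lemma A_norm_le:
  assumes "\<And>x. norm (g x) \<le> C" "0 \<le> C"
  shows "norm (A N g x) \<le> C"
proof (cases "N = 0")
  case False
  have "norm (\<Sum>n<N. cocyc S v n x * g ((S ^^ n) x)) \<le> (\<Sum>n<N. C)"
    by (intro sum_norm_le) (simp add: norm_mult norm_cocyc[OF v_norm] assms)
  then show ?thesis using False by (simp add: A_def norm_divide divide_simps mult.commute)
qed (use assms in \<open>simp add: A_def\<close>)

lemma b_cont: "continuous_on UNIV (b N)"
  by (rule A_cont[OF f_cont])

lemma I_b_decreasing:
  assumes "N \<ge> 1" "M \<ge> 1"
  shows "I (b N) \<le> I (b M) + 4 * B\<^sup>2 * real M / real N"
proof -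
  have "I (b N) \<le> I (A N (b M)) + 2 * B * (2 * real M * B / real N)"
    using A_b_close[OF assms] b_bd B_nonneg A_norm_le[of "b M" B N, OF b_bd B_nonneg]
    by (intro I_perturb b_cont A_cont[OF b_cont]) (auto simp: norm_minus_commute)
  also have "I (A N (b M)) \<le> I (b M)" by (rule A_contraction[OF assms(1) b_cont])
  finally show ?thesis by (simp add: power2_eq_square mult_ac)
qed

lemma I_b_midpoint:
  assumes "M \<ge> 1" "N \<ge> 1" "L \<ge> 1"
  shows "4 * I (b L) \<le> I (\<lambda>x. b M x + b N x) + 8 * B\<^sup>2 * (real M + real N) / real L"
proof -
  have lin: "A L (\<lambda>x. b M x + b N x) x = A L (b M) x + A L (b N) x" for x
    unfolding A_def[of L] by (simp add: distrib_left sum.distrib add_divide_distrib)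
  have cs: "continuous_on UNIV (\<lambda>x. b M x + b N x)" by (intro continuous_intros b_cont)
  have "4 * I (b L) = I (\<lambda>x. 2 * b L x)"
    unfolding I_def by (simp add: norm_mult power_mult_distrib)
  also have "\<dots> \<le> I (A L (\<lambda>x. b M x + b N x)) + 2 * (2 * B) * (2 * real M * B / real L + 2 * real N * B / real L)"
  proof (rule I_perturb)
    fix x
    show "norm (2 * b L x - A L (\<lambda>x. b M x + b N x) x) \<le> 2 * real M * B / real L + 2 * real N * B / real L"
    proof -
      have "2 * b L x - A L (\<lambda>x. b M x + b N x) x = - ((A L (b M) x - b L x) + (A L (b N) x - b L x))"
        unfolding lin by simp
      then show ?thesis
        using norm_triangle_mono[OF A_b_close[where N=L and H=M and x=x] A_b_close[where N=L and H=N and x=x]] assms by (simp only: norm_minus_cancel)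
    qed
    show "norm (A L (\<lambda>x. b M x + b N x) x) \<le> 2 * B"
      unfolding lin using norm_triangle_ineq[of "A L (b M) x" "A L (b N) x"]
        A_norm_le[of "b M" B L x, OF b_bd B_nonneg] A_norm_le[of "b N" B L x, OF b_bd B_nonneg] by linarith
  qed (use b_bd in \<open>auto simp: norm_mult intro!: continuous_intros b_cont A_cont cs\<close>)
  also have "I (A L (\<lambda>x. b M x + b N x)) \<le> I (\<lambda>x. b M x + b N x)" by (rule A_contraction[OF assms(3) cs])
  finally show ?thesis by (simp add: power2_eq_square algebra_simps add_divide_distrib)
qed

lemma I_parallelogram:
  assumes "continuous_on UNIV p" "continuous_on UNIV q"
  shows "I (\<lambda>x. p x - q x) = 2 * I p + 2 * I q - I (\<lambda>x. p x + q x)"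
proof -
  have pw: "(norm (p x - q x))\<^sup>2 = 2 * (norm (p x))\<^sup>2 + 2 * (norm (q x))\<^sup>2 - (norm (p x + q x))\<^sup>2" for x
    unfolding cmod_power2 by (simp add: power2_eq_square algebra_simps)
  have i: "integrable \<mu> (\<lambda>x. (norm (p x))\<^sup>2)" "integrable \<mu> (\<lambda>x. (norm (q x))\<^sup>2)"
    "integrable \<mu> (\<lambda>x. (norm (p x + q x))\<^sup>2)"
    using assms by (auto intro!: I_integrable continuous_intros)
  show ?thesis unfolding I_def pw using i by simp
qed

lemma I_nonneg: "0 \<le> I g"
  unfolding I_def by simp

lemma I_b_Cauchy:
  assumes e: "\<epsilon> > 0"
  shows "\<exists>N0. \<forall>M\<ge>N0. \<forall>N\<ge>N0. I (\<lambda>x. b M x - b N x) \<le> \<epsilon>"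
proof -
  define d where "d = Inf ((\<lambda>N. I (b N)) ` {1..})"
  have bdd: "bdd_below ((\<lambda>N. I (b N)) ` {1..})" using I_nonneg by (intro bdd_belowI) auto
  have d_le: "d \<le> I (b N)" if "N \<ge> 1" for N
    unfolding d_def using that bdd by (intro cInf_lower) auto
  obtain M0 where M0: "M0 \<ge> 1" "I (b M0) < d + \<epsilon>/8"
  proof -
    have "Inf ((\<lambda>N. I (b N)) ` {1..}) < d + \<epsilon>/8" unfolding d_def using e by simp
    then have "\<exists>y\<in>(\<lambda>N. I (b N)) ` {1..}. y < d + \<epsilon>/8" using bdd by (subst (asm) cInf_less_iff) auto
    then show ?thesis using that by auto
  qed
  obtain N1 :: nat where N1: "32 * B\<^sup>2 * real M0 / \<epsilon> \<le> real N1" using real_arch_simple by blast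
  \<comment> \<open>The share \<epsilon>/4 is what the parallelogram identity allows: 2 (d +
    \<epsilon>/4) + 2 (d + \<epsilon>/4) - 4 d = \<epsilon>.\<close>
  have up: "I (b N) \<le> d + \<epsilon>/4" if "N \<ge> max 1 N1" for N
  proof -
    have "32 * B\<^sup>2 * real M0 / \<epsilon> \<le> real N" "real N > 0" using N1 that by auto
    then have "4 * B\<^sup>2 * real M0 / real N \<le> \<epsilon>/8" using e by (simp add: field_simps)
    then show ?thesis using I_b_decreasing[of N M0] M0 that by auto
  qed
  have low: "4 * d \<le> I (\<lambda>x. b M x + b N x)" if MN: "M \<ge> 1" "N \<ge> 1" for M N
  proof (rule field_le_epsilon)
    fix \<eta> :: real assume h: "\<eta> > 0"
    obtain L :: nat where L: "8 * B\<^sup>2 * (real M + real N) / \<eta> \<le> real L" using real_arch_simple by blast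
    have L': "8 * B\<^sup>2 * (real M + real N) / \<eta> \<le> real (max 1 L)" "real (max 1 L) > 0" using L by auto
    then have "8 * B\<^sup>2 * (real M + real N) / real (max 1 L) \<le> \<eta>" using h by (simp add: field_simps)
    then show "4 * d \<le> I (\<lambda>x. b M x + b N x) + \<eta>"
      using I_b_midpoint[OF MN, of "max 1 L"] d_le[of "max 1 L"] by auto
  qed
  show ?thesis
  proof (intro exI[of _ "max 1 N1"] allI impI)
    fix M N assume "M \<ge> max 1 N1" "N \<ge> max 1 N1"
    then show "I (\<lambda>x. b M x - b N x) \<le> \<epsilon>"
      unfolding I_parallelogram[OF b_cont b_cont] using up[of M] up[of N] low[of M N] by auto
  qed
qed

lemma L1_le_I:
  assumes g: "continuous_on UNIV g" and "\<eta> > 0" "I g \<le> \<eta>\<^sup>2"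
  shows "(\<integral>x. norm (g x) \<partial>\<mu>) \<le> \<eta>"
proof -
  have am: "norm (g x) \<le> (\<eta> + (norm (g x))\<^sup>2 / \<eta>) / 2" for x
  proof -
    have "0 \<le> (norm (g x) - \<eta>)\<^sup>2" by simp
    then show ?thesis using assms(2) by (simp add: field_simps power2_eq_square)
  qed
  have "(\<integral>x. norm (g x) \<partial>\<mu>) \<le> (\<integral>x. (\<eta> + (norm (g x))\<^sup>2 / \<eta>) / 2 \<partial>\<mu>)"
    using am I_integrable[OF g]
    by (intro integral_mono integrable_cont) (use assms(2) in \<open>auto intro!: continuous_intros g\<close>)
  also have "\<dots> = (\<eta> + I g / \<eta>) / 2"
    unfolding I_def using I_integrable[OF g] by simp
  also have "\<dots> \<le> \<eta>" using assms by (simp add: field_simps power2_eq_square)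
  finally show ?thesis .
qed

text \<open>The averages are Cauchy by the parallelogram identity, since their norms nearly attain the
  infimum and the midpoint of two averages is almost as long as a much later average. The limit is
  a fixed vector, hence orthogonal to f and to all averages, hence zero.\<close>

lemma mean_ergodic:
  assumes hyp: "\<And>\<phi>. \<phi> \<in> borel_measurable \<mu> \<Longrightarrow> (\<And>x. norm (\<phi> x) \<le> B) \<Longrightarrow>
      (AE x in \<mu>. v x * \<phi> (S x) = \<phi> x) \<Longrightarrow> (\<integral>x. f x * cnj (\<phi> x) \<partial>\<mu>) = 0"
    and e: "\<epsilon> > 0"
  shows "\<exists>M\<ge>1. I (b M) \<le> \<epsilon>"
proof -
  have bi: "integrable \<mu> (b N)" for N by (rule integrable_cont[OF b_cont])
  have "\<exists>N. \<forall>i\<ge>N. \<forall>j\<ge>N. (\<integral>x. norm (b i x - b j x) \<partial>\<mu>) < \<eta>" if h: "\<eta> > 0" for \<eta>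
  proof -
    obtain N where N: "\<forall>i\<ge>N. \<forall>j\<ge>N. I (\<lambda>x. b i x - b j x) \<le> (\<eta>/2)\<^sup>2"
      using I_b_Cauchy[of "(\<eta>/2)\<^sup>2"] h by auto
    have "(\<integral>x. norm (b i x - b j x) \<partial>\<mu>) \<le> \<eta>/2" if "i \<ge> N" "j \<ge> N" for i j
      using N that h by (intro L1_le_I continuous_intros b_cont) auto
    moreover have "\<eta>/2 < \<eta>" using h by simp
    ultimately show ?thesis by (meson le_less_trans)
  qed
  from cauchy_L1_AE_cauchy_subseq[OF bi this] obtain r where r: "strict_mono r"
    and rC: "AE x in \<mu>. Cauchy (\<lambda>i. b (r i) x)" by blast
  define \<phi>0 where "\<phi>0 x = lim (\<lambda>i. b (r i) x)" for x
  \<comment> \<open>The pointwise limit obeys the bound B only almost everywhere, whereas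
    \<open>hyp\<close> asks for it at every point.\<close>
  define \<phi> where "\<phi> x = (if norm (\<phi>0 x) \<le> B then \<phi>0 x else 0)" for x
  have bm [measurable]: "b N \<in> borel_measurable \<mu>" for N by (rule measurable_cont[OF b_cont])
  have [measurable]: "\<phi>0 \<in> borel_measurable \<mu>" unfolding \<phi>0_def[abs_def] by measurable
  have phim [measurable]: "\<phi> \<in> borel_measurable \<mu>" unfolding \<phi>_def[abs_def] by measurable
  have phiB: "norm (\<phi> x) \<le> B" for x unfolding \<phi>_def using B_nonneg by auto
  have lim: "AE x in \<mu>. (\<lambda>i. b (r i) x) \<longlonglongrightarrow> \<phi> x"
    using rC
  proof eventually_elim
    case (elim x)
    then have c: "(\<lambda>i. b (r i) x) \<longlonglongrightarrow> \<phi>0 x"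
      unfolding \<phi>0_def by (simp add: Cauchy_convergent convergent_LIMSEQ_iff[symmetric])
    have "norm (\<phi>0 x) \<le> B"
      using tendsto_norm[OF c] b_bd by (intro tendsto_upperbound[of _ _ sequentially]) auto
    then show ?case using c unfolding \<phi>_def by simp
  qed
  have r1: "r i \<ge> i" for i using seq_suble[OF r] .
  have fn: "(\<lambda>i. 2 * B / real (r i)) \<longlonglongrightarrow> 0"
    using LIMSEQ_subseq_LIMSEQ[OF lim_const_over_n[of "2*B"] r] by (simp add: comp_def)
  have fix': "AE x in \<mu>. v x * \<phi> (S x) = \<phi> x"
    using lim AE_S[OF lim]
  proof eventually_elim
    case (elim x)
    have "norm (v x * b N (S x) - b N x) \<le> 2 * B / real N" for N
    proof -
      define a where "a n = cocyc S v n x * f ((S ^^ n) x)" for n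
      have aB: "norm (a n) \<le> B" for n unfolding a_def by (simp add: norm_mult norm_cocyc[OF v_norm] f_bd)
      have "v x * (cocyc S v n (S x) * f ((S ^^ n) (S x))) = a (Suc n)" for n
        unfolding a_def using cocyc_add[of S v 1 n x] by (simp add: cocyc_Suc funpow_swap1 mult.assoc)
      then have "v x * b N (S x) = (\<Sum>n<N. a (Suc n)) / of_nat N"
        unfolding A_def times_divide_eq_right sum_distrib_left by simp
      then have "v x * b N (S x) - b N x = (a N - a 0) / of_nat N"
        unfolding A_def a_def[symmetric] using sum_lessThan_telescope[of a N]
        by (simp only: diff_divide_distrib[symmetric] sum_subtractf)
      moreover have "norm (a N - a 0) \<le> 2 * B"
        using norm_triangle_ineq4[of "a N" "a 0"] aB[of N] aB[of 0] by linarith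
      ultimately show ?thesis by (simp add: norm_divide divide_right_mono)
    qed
    then have "(\<lambda>i. v x * b (r i) (S x) - b (r i) x) \<longlonglongrightarrow> 0"
      by (intro Lim_null_comparison[OF _ fn]) (auto intro!: always_eventually)
    moreover have "(\<lambda>i. v x * b (r i) (S x) - b (r i) x) \<longlonglongrightarrow> v x * \<phi> (S x) - \<phi> x"
      using elim by (intro tendsto_intros)
    ultimately show ?case using LIMSEQ_unique by fastforce
  qed
  have orth: "(\<integral>x. f x * cnj (\<phi> x) \<partial>\<mu>) = 0" by (rule hyp[OF phim phiB fix'])
  have fm [measurable]: "f \<in> borel_measurable \<mu>" by (rule measurable_cont[OF f_cont])
  have cm [measurable]: "cocyc S v n \<in> borel_measurable \<mu>" for n by (rule measurable_cont[OF cocyc_cont])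
  have fixn: "AE x in \<mu>. cocyc S v n x * \<phi> ((S ^^ n) x) = \<phi> x" for n
  proof (induction n)
    case (Suc n)
    with AE_Sn[OF fix', of n] show ?case
    proof eventually_elim
      case (elim x)
      then show ?case by (simp add: cocyc_Suc mult.assoc)
    qed
  qed simp
  \<comment> \<open>The isometry preserves inner products and fixes \<phi>, so pairing its n-th
    iterate of f with \<phi> is the same as pairing f with \<phi>.\<close>
  have term0: "(\<integral>x. (cocyc S v n x * f ((S ^^ n) x)) * cnj (\<phi> x) \<partial>\<mu>) = 0" for n
  proof -
    have "(\<integral>x. (cocyc S v n x * f ((S ^^ n) x)) * cnj (\<phi> x) \<partial>\<mu>)
      = (\<integral>x. f ((S ^^ n) x) * cnj (\<phi> ((S ^^ n) x)) \<partial>\<mu>)"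
    proof (rule integral_cong_AE)
      show "AE x in \<mu>. (cocyc S v n x * f ((S ^^ n) x)) * cnj (\<phi> x) = f ((S ^^ n) x) * cnj (\<phi> ((S ^^ n) x))"
        using fixn[of n]
      proof eventually_elim
        case (elim x)
        have "cocyc S v n x * cnj (cocyc S v n x) = 1"
          using complex_norm_square[of "cocyc S v n x"] norm_cocyc[OF v_norm, where S=S and n=n and x=x] by simp
        then show ?case unfolding elim[symmetric] by (simp add: mult_ac)
      qed
    qed measurable
    also have "\<dots> = 0" using integral_Sn[of "\<lambda>x. f x * cnj (\<phi> x)" n] orth by simp
    finally show ?thesis .
  qed
  have bphi: "(\<integral>x. b N x * cnj (\<phi> x) \<partial>\<mu>) = 0" for N
  proof -
    have int: "integrable \<mu> (\<lambda>x. (cocyc S v n x * f ((S ^^ n) x)) * cnj (\<phi> x))" for n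
      using B_nonneg by (intro integrable_const_bound[of _ "B*B"]) 
        (auto simp: norm_mult norm_cocyc[OF v_norm] intro!: mult_mono f_bd phiB)
    have "(\<integral>x. b N x * cnj (\<phi> x) \<partial>\<mu>) = (\<integral>x. (\<Sum>n<N. (cocyc S v n x * f ((S ^^ n) x)) * cnj (\<phi> x)) / of_nat N \<partial>\<mu>)"
      by (simp add: A_def sum_distrib_right)
    also have "\<dots> = 0" using int term0 by simp
    finally show ?thesis .
  qed
  have "(\<lambda>i. \<integral>x. b (r i) x * cnj (\<phi> x) \<partial>\<mu>) \<longlonglongrightarrow> (\<integral>x. \<phi> x * cnj (\<phi> x) \<partial>\<mu>)"
  proof (rule integral_dominated_convergence[where w="\<lambda>_. B * B"])
    show "AE x in \<mu>. (\<lambda>i. b (r i) x * cnj (\<phi> x)) \<longlonglongrightarrow> \<phi> x * cnj (\<phi> x)"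
      using lim by eventually_elim (intro tendsto_intros)
    show "\<And>i. AE x in \<mu>. norm (b (r i) x * cnj (\<phi> x)) \<le> B * B"
      using B_nonneg by (intro AE_I2) (auto simp: norm_mult intro!: mult_mono b_bd phiB)
  qed auto
  then have "(\<integral>x. \<phi> x * cnj (\<phi> x) \<partial>\<mu>) = 0" unfolding bphi by (simp add: LIMSEQ_const_iff)
  then have "complex_of_real (\<integral>x. (norm (\<phi> x))\<^sup>2 \<partial>\<mu>) = 0"
    by (simp only: complex_norm_square[symmetric] integral_complex_of_real)
  then have I0: "(\<integral>x. (norm (\<phi> x))\<^sup>2 \<partial>\<mu>) = 0" by simp
  have "(\<lambda>i. I (b (r i))) \<longlonglongrightarrow> (\<integral>x. (norm (\<phi> x))\<^sup>2 \<partial>\<mu>)"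
    unfolding I_def
  proof (rule integral_dominated_convergence[where w="\<lambda>_. B\<^sup>2"])
    show "AE x in \<mu>. (\<lambda>i. (norm (b (r i) x))\<^sup>2) \<longlonglongrightarrow> (norm (\<phi> x))\<^sup>2"
      using lim by eventually_elim (intro tendsto_intros)
    show "\<And>i. AE x in \<mu>. norm ((norm (b (r i) x))\<^sup>2) \<le> B\<^sup>2"
      using b_bd by (intro AE_I2) (auto intro!: power_mono)
  qed auto
  then have "\<forall>\<^sub>F i in sequentially. I (b (r i)) < \<epsilon>" unfolding I0 using e by (rule order_tendstoD)
  then obtain i where "i \<ge> 1" "I (b (r i)) < \<epsilon>"
    unfolding eventually_sequentially by (metis nat_le_linear)
  then show ?thesis using r1[of i] by (intro exI[of _ "r i"]) auto
qed

text \<open>For the twisted averages, convergence in mean upgrades to uniform convergence: by unique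
  ergodicity the window averages of the continuous function b M are uniformly small.\<close>

lemma uniform_twisted:
  assumes hyp: "\<And>\<phi>. \<phi> \<in> borel_measurable \<mu> \<Longrightarrow> (\<And>x. norm (\<phi> x) = 1) \<Longrightarrow>
      (AE x in \<mu>. \<phi> (S x) * cnj (\<phi> x) = cnj (v x)) \<Longrightarrow> (\<integral>x. f x * cnj (\<phi> x) \<partial>\<mu>) = 0"
    and e: "\<epsilon> > 0"
  shows "\<exists>N0. \<forall>N\<ge>N0. \<forall>x. norm (\<Sum>n<N. cocyc S v n x * f ((S ^^ n) x)) \<le> \<epsilon> * real N"
proof -
  have "\<exists>M\<ge>1. I (b M) \<le> (\<epsilon>/4)\<^sup>2"
  proof (rule mean_ergodic)
    fix \<phi> assume m: "\<phi> \<in> borel_measurable \<mu>" and bd: "\<And>x. norm (\<phi> x) \<le> B"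
      and fx: "AE x in \<mu>. v x * \<phi> (S x) = \<phi> x"
    note [measurable] = m
    have fm [measurable]: "f \<in> borel_measurable \<mu>" by (rule measurable_cont[OF f_cont])
    \<comment> \<open>The modulus of a fixed vector is S-invariant, hence constant. Dividing by it
      reduces bounded fixed vectors to the unimodular ones of \<open>hyp\<close>.\<close>
    have "AE x in \<mu>. complex_of_real (norm (\<phi> (S x))) = complex_of_real (norm (\<phi> x))"
      using fx by eventually_elim (metis mult_1 norm_mult v_norm)
    then have "\<exists>c. AE x in \<mu>. complex_of_real (norm (\<phi> x)) = c"
      using bd by (intro invariant_complex_const[where B=B]) auto
    then obtain c where c: "AE x in \<mu>. complex_of_real (norm (\<phi> x)) = c" by blast
    show "(\<integral>x. f x * cnj (\<phi> x) \<partial>\<mu>) = 0"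
    proof (cases "c = 0")
      case True
      with c have "AE x in \<mu>. f x * cnj (\<phi> x) = 0" by (auto elim: eventually_mono)
      then show ?thesis by (rule integral_eq_zero_AE)
    next
      case False
      \<comment> \<open>The value 1 on the exceptional null set makes \<psi> unimodular at every
        point.\<close>
      define \<psi> where "\<psi> x = (if complex_of_real (norm (\<phi> x)) = c then \<phi> x / c else 1)" for x
      have [measurable]: "\<psi> \<in> borel_measurable \<mu>" unfolding \<psi>_def[abs_def] by measurable
      have u: "norm (\<psi> x) = 1" for x
        unfolding \<psi>_def using False by (auto simp: norm_divide)
      have eq: "AE x in \<mu>. \<phi> x = c * \<psi> x" using c by eventually_elim (simp add: \<psi>_def False)
      have "AE x in \<mu>. \<psi> (S x) * cnj (\<psi> x) = cnj (v x)"
        using eq AE_S[OF eq] fx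
      proof eventually_elim
        case (elim x)
        have "c * (v x * \<psi> (S x)) = c * \<psi> x" using elim by (metis mult.assoc mult.commute)
        then have a: "\<psi> x = v x * \<psi> (S x)" using False by simp
        have "\<psi> (S x) * cnj (\<psi> (S x)) = 1" using complex_norm_square[of "\<psi> (S x)"] u by simp
        then show ?case unfolding a by (simp add: mult_ac)
      qed
      then have "(\<integral>x. f x * cnj (\<psi> x) \<partial>\<mu>) = 0" using u by (intro hyp) auto
      moreover have "(\<integral>x. f x * cnj (\<phi> x) \<partial>\<mu>) = (\<integral>x. cnj c * (f x * cnj (\<psi> x)) \<partial>\<mu>)"
      proof (rule integral_cong_AE)
        show "AE x in \<mu>. f x * cnj (\<phi> x) = cnj c * (f x * cnj (\<psi> x))"
          using eq by eventually_elim simp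
        show "(\<lambda>x. f x * cnj (\<phi> x)) \<in> borel_measurable \<mu>"
          by measurable
        show "(\<lambda>x. cnj c * (f x * cnj (\<psi> x))) \<in> borel_measurable \<mu>"
          by measurable
      qed
      ultimately show ?thesis by simp
    qed
  qed (use e in simp)
  then obtain M where M: "M \<ge> 1" "I (b M) \<le> (\<epsilon>/4)\<^sup>2" by blast
  \<comment> \<open>Budget: \<epsilon>/4 for this integral, \<epsilon>/4 for its approximation by
    orbit averages, \<epsilon>/2 for replacing f by the window averages \<open>b M\<close>.\<close>
  have L1: "(\<integral>x. norm (b M x) \<partial>\<mu>) \<le> \<epsilon>/4" using M e by (intro L1_le_I b_cont) auto
  have "continuous_on UNIV (\<lambda>x. norm (b M x))" by (intro continuous_intros b_cont)
  from uniform_averages[OF this, of "\<epsilon>/4"] e obtain N0 where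
    N0: "\<forall>N\<ge>N0. \<forall>x. \<bar>(\<Sum>n<N. norm (b M ((S ^^ n) x))) - real N * (\<integral>x. norm (b M x) \<partial>\<mu>)\<bar> \<le> \<epsilon>/4 * real N"
    by auto
  obtain N1 :: nat where N1: "4 * real M * B / \<epsilon> \<le> real N1" using real_arch_simple by blast
  show ?thesis
  proof (intro exI[of _ "max N0 N1"] allI impI)
    fix N x assume N: "max N0 N1 \<le> N"
    have "real N * (\<integral>x. norm (b M x) \<partial>\<mu>) \<le> real N * (\<epsilon>/4)" using L1 by (intro mult_left_mono) auto
    moreover have "\<bar>(\<Sum>n<N. norm (b M ((S ^^ n) x))) - real N * (\<integral>x. norm (b M x) \<partial>\<mu>)\<bar> \<le> \<epsilon>/4 * real N"
      using N0 N by simp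
    ultimately have "(\<Sum>n<N. norm (b M ((S ^^ n) x))) \<le> real N * (\<epsilon>/4) + \<epsilon>/4 * real N" by linarith
    then have s1: "(\<Sum>n<N. norm (b M ((S ^^ n) x))) \<le> (\<epsilon>/2) * real N" by argo
    have s2: "norm (\<Sum>n<N. cocyc S v n x * b M ((S ^^ n) x)) \<le> (\<Sum>n<N. norm (b M ((S ^^ n) x)))"
      by (rule order_trans[OF norm_sum]) (simp add: norm_mult norm_cocyc[OF v_norm])
    have "real M * norm ((\<Sum>n<N. cocyc S v n x * b M ((S ^^ n) x)) - (\<Sum>n<N. cocyc S v n x * f ((S ^^ n) x)))
        \<le> real M * (2 * real M * B)"
      using windows_bound[where H=M and N=N and x=x] unfolding right_diff_distrib[symmetric]
      by (simp add: norm_mult power2_eq_square mult_ac)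
    then have s3: "norm ((\<Sum>n<N. cocyc S v n x * b M ((S ^^ n) x)) - (\<Sum>n<N. cocyc S v n x * f ((S ^^ n) x)))
        \<le> 2 * real M * B" using M(1) by simp
    have "4 * real M * B / \<epsilon> \<le> real N" using N1 N by simp
    then have s4: "2 * real M * B \<le> (\<epsilon>/2) * real N" using e by (simp add: field_simps)
    show "norm (\<Sum>n<N. cocyc S v n x * f ((S ^^ n) x)) \<le> \<epsilon> * real N"
      using s1 s2 s3 s4 norm_triangle_sub[of "\<Sum>n<N. cocyc S v n x * f ((S ^^ n) x)" "\<Sum>n<N. cocyc S v n x * b M ((S ^^ n) x)"]
        norm_minus_commute[of "\<Sum>n<N. cocyc S v n x * f ((S ^^ n) x)" "\<Sum>n<N. cocyc S v n x * b M ((S ^^ n) x)"]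
      by argo
  qed
qed

end

section \<open>Phases with prescribed differences\<close>

definition dif :: "(nat \<Rightarrow> complex) \<Rightarrow> nat \<Rightarrow> complex" where
  "dif u n = u (Suc n) * cnj (u n)"

definition orb :: "nat \<Rightarrow> ('a \<Rightarrow> 'a) \<Rightarrow> ('a \<Rightarrow> complex) \<Rightarrow> 'a \<Rightarrow> (nat \<Rightarrow> complex) \<Rightarrow> bool" where
  "orb l S v x u \<longleftrightarrow> (\<forall>n. norm (u n) = 1) \<and> (\<forall>n. (dif ^^ l) u n = v ((S ^^ n) x))"

text \<open>For v = 1 and l = k + 1, the sequences u below are the polynomial phases of degree at most k.\<close>

definition seqs :: "nat \<Rightarrow> ('a \<Rightarrow> 'a) \<Rightarrow> ('a \<Rightarrow> complex) \<Rightarrow> ('a \<Rightarrow> complex) \<Rightarrow> (nat \<Rightarrow> complex) set" where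
  "seqs l S v f = {\<lambda>n. u n * f ((S ^^ n) x) |x u. orb l S v x u}"

lemma seqsI: "orb l S v x u \<Longrightarrow> (\<And>n. a n = u n * f ((S ^^ n) x)) \<Longrightarrow> a \<in> seqs l S v f"
  unfolding seqs_def by blast

section \<open>Iterated multiplicative differences and operations on phase families\<close>

lemma unimodular_mult_cnj: "norm z = 1 \<Longrightarrow> z * cnj z = 1"
  using complex_norm_square[of z] by simp

lemma unimodular_cnj_mult: "norm z = 1 \<Longrightarrow> cnj z * z = 1"
  using unimodular_mult_cnj[of z] by (simp add: mult.commute)

lemma dif_iter_norm: "(\<And>n. norm (u n) = 1) \<Longrightarrow> norm ((dif ^^ l) u n) = 1"
  by (induction l arbitrary: n) (auto simp: dif_def norm_mult)

lemma dif_iter_shift: "(dif ^^ l) (\<lambda>n. u (n + m)) = (\<lambda>n. (dif ^^ l) u (n + m))"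
  by (induction l) (auto simp: dif_def fun_eq_iff)

lemma dif_iter_mult: "(dif ^^ l) (\<lambda>n. u n * w n) = (\<lambda>n. (dif ^^ l) u n * (dif ^^ l) w n)"
  by (induction l) (auto simp: dif_def fun_eq_iff mult_ac)

lemma dif_iter_cnj: "(dif ^^ l) (\<lambda>n. cnj (u n)) = (\<lambda>n. cnj ((dif ^^ l) u n))"
  by (induction l) (auto simp: dif_def fun_eq_iff)

lemma orb_shift: "orb l S v x u \<Longrightarrow> orb l S v (S x) (\<lambda>n. u (Suc n))"
  using dif_iter_shift[of l u 1] by (simp add: orb_def funpow_swap1)

text \<open>Shifting a sequence replaces x by \<open>S x\<close>; this is why \<open>seqs\<close>
  collects all starting points.\<close>

lemma seqs_shift_closed: "shift_closed (seqs l S v f)"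
  unfolding shift_closed_def
proof
  fix a assume "a \<in> seqs l S v f"
  then obtain x u where a: "a = (\<lambda>n. u n * f ((S ^^ n) x))" "orb l S v x u" unfolding seqs_def by blast
  show "(\<lambda>n. a (Suc n)) \<in> seqs l S v f" by (rule seqsI[OF orb_shift[OF a(2)]]) (simp add: a(1) funpow_swap1)
qed

lemma seqs_bounded:
  assumes "\<And>x. norm (f x) \<le> B"
  shows "\<forall>a\<in>seqs l S v f. \<forall>n. norm (a n) \<le> B"
  unfolding seqs_def using assms by (auto simp: orb_def norm_mult)

text \<open>The l-th difference w of u grows by the factor v at each orbit step, so w (n + h) / w n
  is the cocycle over h steps. Iterated differences are multiplicative and commute with shifts, so
  this quotient is the l-th difference of u (n + h) / u n.\<close>

lemma orb_difference:
  assumes "orb (Suc l) S v x u"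
  shows "orb l S (cocyc S v h) x (\<lambda>n. u (n + h) * cnj (u n))"
proof -
  define w where "w = (dif ^^ l) u"
  have u1: "norm (u n) = 1" for n using assms unfolding orb_def by simp
  have w1: "norm (w n) = 1" for n unfolding w_def by (rule dif_iter_norm[OF u1])
  have wS: "w (Suc n) = w n * v ((S ^^ n) x)" for n
  proof -
    have "w (Suc n) * cnj (w n) = v ((S ^^ n) x)" using assms unfolding orb_def w_def by (simp add: dif_def)
    then show ?thesis using unimodular_mult_cnj[OF w1[of n]] by (metis mult.assoc mult.commute mult.right_neutral)
  qed
  have wh: "w (n + h) = w n * cocyc S v h ((S ^^ n) x)" for n
  proof (induction h)
    case (Suc h)
    have "(S ^^ (n + h)) x = (S ^^ h) ((S ^^ n) x)" by (metis add.commute comp_apply funpow_add)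
    then show ?case using wS[of "n + h"] Suc by (simp add: cocyc_Suc mult.assoc)
  qed simp
  have "(dif ^^ l) (\<lambda>n. u (n + h) * cnj (u n)) n = w (n + h) * cnj (w n)" for n
    unfolding dif_iter_mult dif_iter_shift dif_iter_cnj w_def ..
  also have "w (n + h) * cnj (w n) = cocyc S v h ((S ^^ n) x)" for n
    unfolding wh using unimodular_mult_cnj[OF w1[of n]] by (metis mult.assoc mult.commute mult.right_neutral)
  finally show ?thesis unfolding orb_def using u1 by (simp add: norm_mult)
qed

text \<open>Correlations of phase sequences are again phase sequences with one difference fewer; the
  price is that v becomes a block cocycle and f a correlation of f.\<close>

lemma unif0_seqs_van_der_Corput:
  assumes fB: "\<And>x. norm (f x) \<le> B"
    and corr: "\<And>h. h \<ge> 1 \<Longrightarrow> unif0 (seqs l S (cocyc S v h) (\<lambda>x. f ((S ^^ h) x) * cnj (f x)))"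
  shows "unif0 (seqs (Suc l) S v f)"
proof (rule unif0_van_der_Corput[OF seqs_shift_closed seqs_bounded[OF fB]])
  fix h :: nat assume h: "h \<ge> 1"
  show "unif0 ((\<lambda>a n. a (n + h) * cnj (a n)) ` seqs (Suc l) S v f)"
  proof (rule unif0_subset[OF corr[OF h]], rule image_subsetI)
    fix a assume "a \<in> seqs (Suc l) S v f"
    then obtain x u where a: "a = (\<lambda>n. u n * f ((S ^^ n) x))" "orb (Suc l) S v x u" unfolding seqs_def by blast
    have "(S ^^ (n + h)) x = (S ^^ h) ((S ^^ n) x)" for n by (metis add.commute comp_apply funpow_add)
    then show "(\<lambda>n. a (n + h) * cnj (a n)) \<in> seqs l S (cocyc S v h) (\<lambda>x. f ((S ^^ h) x) * cnj (f x))"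
      by (intro seqsI[OF orb_difference[OF a(2), of h]]) (simp add: a(1) mult_ac)
  qed
qed

text \<open>A difference of the subsampled phase is the subsample of u (n + M) / u n, so
  \<open>orb_difference\<close> with h = M applies l times, and each application replaces the
  current function by its cocycle over M steps of S.\<close>

lemma orb_subsample:
  "orb l S v x u \<Longrightarrow> orb l (S ^^ M) (((\<lambda>w. cocyc S w M) ^^ l) v) x (\<lambda>n. u (M * n))"
proof (induction l arbitrary: u v)
  case 0
  then show ?case unfolding orb_def by (auto simp: funpow_mult)
next
  case (Suc l)
  have u1: "norm (u n) = 1" for n using Suc.prems unfolding orb_def by simp
  have "dif (\<lambda>n. u (M * n)) = (\<lambda>n. u (M * n + M) * cnj (u (M * n)))"
    by (simp add: dif_def fun_eq_iff add.commute)
  then have "(dif ^^ Suc l) (\<lambda>n. u (M * n)) = (dif ^^ l) (\<lambda>n. u (M * n + M) * cnj (u (M * n)))"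
    by (simp add: funpow_Suc_right del: funpow.simps)
  moreover have "((\<lambda>w. cocyc S w M) ^^ Suc l) v = ((\<lambda>w. cocyc S w M) ^^ l) (cocyc S v M)"
    by (simp add: funpow_Suc_right del: funpow.simps)
  ultimately show ?case
    using Suc.IH[OF orb_difference[OF Suc.prems, of M]] u1 unfolding orb_def by simp
qed

lemma unif0_seqs_subsample:
  assumes fB: "\<And>x. norm (f x) \<le> B" and M: "M \<ge> 1"
    and u: "unif0 (seqs l (S ^^ M) (((\<lambda>w. cocyc S w M) ^^ l) v) f)"
  shows "unif0 (seqs l S v f)"
proof (rule unif0_subsample[OF seqs_shift_closed seqs_bounded[OF fB] M], rule unif0_subset[OF u], rule image_subsetI)
  fix a assume "a \<in> seqs l S v f"
  then obtain x u where a: "a = (\<lambda>n. u n * f ((S ^^ n) x))" "orb l S v x u" unfolding seqs_def by blast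
  show "(\<lambda>n. a (M * n)) \<in> seqs l (S ^^ M) (((\<lambda>w. cocyc S w M) ^^ l) v) f"
    by (rule seqsI[OF orb_subsample[OF a(2), of M]]) (simp add: a(1) funpow_mult)
qed

text \<open>Pascal's rule lowers l by one with each difference. Multiplying by this sequence changes
  the constant in an l-th difference by the factor q.\<close>

lemma dif_iter_binomial_power:
  assumes "norm q = 1"
  shows "(dif ^^ l) (\<lambda>n. q ^ (n choose l)) = (\<lambda>_. q)"
proof (induction l)
  case (Suc l)
  have "q ^ (Suc n choose Suc l) * cnj (q ^ (n choose Suc l)) = q ^ (n choose l)" for n
    using unimodular_mult_cnj[of "q ^ (n choose Suc l)"] assms
    by (simp add: power_add norm_power mult.assoc)
  then have "dif (\<lambda>n. q ^ (n choose Suc l)) = (\<lambda>n. q ^ (n choose l))"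
    by (simp add: dif_def fun_eq_iff)
  then show ?case using Suc by (simp add: funpow_Suc_right del: funpow.simps binomial_Suc_Suc)
qed simp

text \<open>Since v is the coboundary of \<open>\<psi>\<close>, the l-th differences are \<open>r \<psi>\<close> for a constant r, and the
  sequences split according to r. Changing r to r' amounts to multiplying by a power sequence with
  exponents n choose l, which on a bounded range is a small perturbation.\<close>

lemma unif0_seqs_coboundary:
  assumes fB: "\<And>x. norm (f x) \<le> B" and psi1: "\<And>x. norm (\<psi> x) = 1"
    and v: "\<And>x. v x = \<psi> (S x) * cnj (\<psi> x)"
    and u: "\<And>r. norm r = 1 \<Longrightarrow> unif0 (seqs l S (\<lambda>x. r * \<psi> x) f)"
  shows "unif0 (seqs (Suc l) S v f)"
proof (rule unif0_stopping[OF seqs_shift_closed seqs_bounded[OF fB]])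
  fix \<epsilon> :: real assume e: "\<epsilon> > 0"
  have B0: "0 \<le> B" using order_trans[OF norm_ge_zero fB] .
  have "\<exists>M. M \<ge> 1 \<and> (\<forall>a\<in>seqs l S (\<lambda>x. r * \<psi> x) f. norm (\<Sum>n<M. a n) \<le> \<epsilon>/2 * real M)" if "norm r = 1" for r
    using unif0D_block[OF u[OF that], of "\<epsilon>/2"] e by (metis half_gt_zero)
  then obtain M where M1: "\<And>r. norm r = 1 \<Longrightarrow> M r \<ge> 1"
    and M2: "\<And>r a. norm r = 1 \<Longrightarrow> a \<in> seqs l S (\<lambda>x. r * \<psi> x) f \<Longrightarrow> norm (\<Sum>n<M r. a n) \<le> \<epsilon>/2 * real (M r)"
    by metis
  \<comment> \<open>Up to the 1 added for positivity, a Lipschitz constant of the block sum of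
    length \<open>M r\<close> under a change of the constant r. The radius \<delta> below makes the
    change at most half of the allowed error.\<close>
  define K where "K r = (\<Sum>n<M r. real (n choose l) * B) + 1" for r
  have K1: "K r \<ge> 1" for r unfolding K_def using B0 by (simp add: sum_nonneg)
  define \<delta> where "\<delta> r = (if norm r = 1 then \<epsilon>/2 * real (M r) / K r else 1)" for r
  have d0: "\<delta> r > 0" for r
    unfolding \<delta>_def using e M1[of r] K1[of r] by (auto intro!: divide_pos_pos mult_pos_pos)
  have pert: "norm (\<Sum>n<M r. a n) \<le> \<epsilon> * real (M r)"
    if r: "norm r = 1" and s: "norm s = 1" and rs: "dist r s < \<delta> r" and a: "a \<in> seqs l S (\<lambda>x. s * \<psi> x) f" for r s a
  proof -
    obtain x u where au: "a = (\<lambda>n. u n * f ((S ^^ n) x))" and o: "orb l S (\<lambda>x. s * \<psi> x) x u"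
      using a unfolding seqs_def by blast
    have u1: "norm (u n) = 1" for n using o unfolding orb_def by simp
    define q where "q = r * cnj s"
    have q1: "norm q = 1" unfolding q_def using r s by (simp add: norm_mult)
    have qs: "q * s = r" unfolding q_def using unimodular_cnj_mult[OF s] by (simp add: mult.assoc)
    have qd: "norm (q - 1) = dist r s"
    proof -
      have "q - 1 = (r - s) * cnj s" unfolding q_def using unimodular_mult_cnj[OF s] by (simp add: left_diff_distrib)
      then show ?thesis using s by (simp add: norm_mult dist_norm)
    qed
    define u' where "u' n = q ^ (n choose l) * u n" for n
    have "orb l S (\<lambda>x. r * \<psi> x) x u'"
      unfolding orb_def u'_def[abs_def] dif_iter_mult dif_iter_binomial_power[OF q1]
      using o u1 q1 qs unfolding orb_def by (simp add: norm_mult norm_power mult.assoc[symmetric])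
    then have "(\<lambda>n. u' n * f ((S ^^ n) x)) \<in> seqs l S (\<lambda>x. r * \<psi> x) f" unfolding seqs_def by blast
    from M2[OF r this] have m: "norm (\<Sum>n<M r. u' n * f ((S ^^ n) x)) \<le> \<epsilon>/2 * real (M r)" .
    have "norm (a n - u' n * f ((S ^^ n) x)) \<le> real (n choose l) * B * dist r s" for n
    proof -
      have "norm (q ^ (n choose l) - 1 ^ (n choose l)) \<le> real (n choose l) * norm (q - 1)"
        using norm_power_diff[of q 1 "n choose l"] q1 by simp
      then have 1: "norm (1 - q ^ (n choose l)) \<le> real (n choose l) * dist r s" using qd by (simp add: norm_minus_commute)
      have "a n - u' n * f ((S ^^ n) x) = (1 - q ^ (n choose l)) * (u n * f ((S ^^ n) x))"
        unfolding au u'_def by (simp add: algebra_simps)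
      then have "norm (a n - u' n * f ((S ^^ n) x)) = norm (1 - q ^ (n choose l)) * norm (f ((S ^^ n) x))"
        using u1 by (simp add: norm_mult)
      also have "\<dots> \<le> (real (n choose l) * dist r s) * B" by (intro mult_mono 1 fB) auto
      finally show ?thesis by (simp add: mult_ac)
    qed
    then have "norm (\<Sum>n<M r. a n - u' n * f ((S ^^ n) x)) \<le> (\<Sum>n<M r. real (n choose l) * B * dist r s)"
      by (intro sum_norm_le)
    also have "\<dots> \<le> K r * dist r s" unfolding K_def sum_distrib_right[symmetric] by (simp add: distrib_right)
    also have "\<dots> \<le> K r * \<delta> r" using rs K1[of r] by (intro mult_left_mono) auto
    also have "\<dots> = \<epsilon>/2 * real (M r)" unfolding \<delta>_def using r K1[of r] by simp
    finally have "norm ((\<Sum>n<M r. a n) - (\<Sum>n<M r. u' n * f ((S ^^ n) x))) \<le> \<epsilon>/2 * real (M r)"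
      by (simp add: sum_subtractf)
    then show ?thesis using m norm_triangle_sub[of "\<Sum>n<M r. a n" "\<Sum>n<M r. u' n * f ((S ^^ n) x)"] by argo
  qed
  \<comment> \<open>The block length depends on r; a finite subcover of the circle leaves finitely
    many lengths, hence the bound that \<open>unif0_stopping\<close> needs.\<close>
  have "compact (sphere (0::complex) 1)" by simp
  moreover have "sphere (0::complex) 1 \<subseteq> (\<Union>r\<in>sphere 0 1. ball r (\<delta> r))" using d0 by auto
  ultimately obtain F where F: "F \<subseteq> sphere 0 1" "finite F" "sphere (0::complex) 1 \<subseteq> (\<Union>r\<in>F. ball r (\<delta> r))"
    using compactE_image[of "sphere 0 1" "sphere 0 1" "\<lambda>r. ball r (\<delta> r)"] by (metis open_ball)
  show "\<exists>K. \<forall>a\<in>seqs (Suc l) S v f. \<exists>M\<in>{1..K}. norm (sum a {..<M}) \<le> \<epsilon> * real M"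
  proof (intro exI ballI)
    fix a assume "a \<in> seqs (Suc l) S v f"
    then obtain x u where a: "a = (\<lambda>n. u n * f ((S ^^ n) x))" "orb (Suc l) S v x u" unfolding seqs_def by blast
    define w where "w = (dif ^^ l) u"
    have u1: "norm (u n) = 1" for n using a(2) unfolding orb_def by simp
    have w1: "norm (w n) = 1" for n unfolding w_def by (rule dif_iter_norm[OF u1])
    define s where "s = w 0 * cnj (\<psi> x)"
    have s1: "norm s = 1" unfolding s_def using w1 psi1 by (simp add: norm_mult)
    have w: "w n = s * \<psi> ((S ^^ n) x)" for n
    proof (induction n)
      case 0
      show ?case unfolding s_def using unimodular_cnj_mult[OF psi1[of x]] by (simp add: mult.assoc)
    next
      case (Suc n)
      have "w (Suc n) * cnj (w n) = v ((S ^^ n) x)" using a(2) unfolding orb_def w_def by (simp add: dif_def)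
      then have "w (Suc n) = v ((S ^^ n) x) * w n"
        using unimodular_cnj_mult[OF w1[of n]] by (metis mult.assoc mult.right_neutral)
      also have "\<dots> = s * \<psi> ((S ^^ Suc n) x) * (cnj (\<psi> ((S ^^ n) x)) * \<psi> ((S ^^ n) x))"
        unfolding Suc v by (simp add: mult_ac)
      finally show ?case unfolding unimodular_cnj_mult[OF psi1] by simp
    qed
    have "orb l S (\<lambda>x. s * \<psi> x) x u" unfolding orb_def using u1 w by (simp add: w_def)
    then have as: "a \<in> seqs l S (\<lambda>x. s * \<psi> x) f" unfolding seqs_def a(1) by blast
    obtain r where r: "r \<in> F" "dist r s < \<delta> r" using F(3) s1 by force
    have r1: "norm r = 1" using r F(1) by auto
    show "\<exists>M\<in>{1..Max (M ` F)}. norm (sum a {..<M}) \<le> \<epsilon> * real M"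
      using pert[OF r1 s1 r(2) as] M1[OF r1] F(2) r(1) by (intro bexI[of _ "M r"]) auto
  qed
qed

section \<open>Coboundaries over a uniquely ergodic map\<close>

context ue_system
begin

text \<open>The transfer function is unimodular everywhere while the equation holds almost
  everywhere: the form in which \<open>unif0_seqs_1\<close> and
  \<open>quasi_eigenfunction_of_power\<close> consume it.\<close>

definition cob :: "('a \<Rightarrow> complex) \<Rightarrow> bool" where
  "cob w \<longleftrightarrow> (\<exists>\<phi>\<in>borel_measurable \<mu>. (\<forall>x. norm (\<phi> x) = 1) \<and> (AE x in \<mu>. \<phi> (S x) * cnj (\<phi> x) = w x))"

lemma cob_mult: "cob w \<Longrightarrow> cob z \<Longrightarrow> cob (\<lambda>x. w x * z x)"
proof -
  assume "cob w" "cob z"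
  then obtain \<phi> \<psi> where [measurable]: "\<phi> \<in> borel_measurable \<mu>" "\<psi> \<in> borel_measurable \<mu>"
    and n: "\<And>x. norm (\<phi> x) = 1" "\<And>x. norm (\<psi> x) = 1"
    and e: "AE x in \<mu>. \<phi> (S x) * cnj (\<phi> x) = w x" "AE x in \<mu>. \<psi> (S x) * cnj (\<psi> x) = z x"
    unfolding cob_def by blast
  have "AE x in \<mu>. (\<phi> (S x) * \<psi> (S x)) * cnj (\<phi> x * \<psi> x) = w x * z x"
    using e by eventually_elim (metis complex_cnj_mult mult.assoc mult.left_commute)
  moreover have "(\<lambda>x. \<phi> x * \<psi> x) \<in> borel_measurable \<mu>" by measurable
  ultimately show ?thesis unfolding cob_def using n
    by (intro bexI[of _ "\<lambda>x. \<phi> x * \<psi> x"]) (auto simp: norm_mult)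
qed

lemma cob_cnj: "cob w \<Longrightarrow> cob (\<lambda>x. cnj (w x))"
proof -
  assume "cob w"
  then obtain \<phi> where m: "\<phi> \<in> borel_measurable \<mu>"
    and n: "\<And>x. norm (\<phi> x) = 1" and e: "AE x in \<mu>. \<phi> (S x) * cnj (\<phi> x) = w x"
    unfolding cob_def by blast
  have "(\<lambda>x. cnj (\<phi> x)) \<in> borel_measurable \<mu>" using m by measurable
  moreover have "AE x in \<mu>. cnj (\<phi> (S x)) * cnj (cnj (\<phi> x)) = cnj (w x)"
    using e by eventually_elim (metis complex_cnj_mult)
  ultimately show ?thesis unfolding cob_def using n
    by (intro bexI[of _ "\<lambda>x. cnj (\<phi> x)"]) auto
qed

lemma cob_one: "cob (\<lambda>_. 1)"
  unfolding cob_def by (intro bexI[of _ "\<lambda>_. 1"]) auto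

lemma cob_power: "cob w \<Longrightarrow> cob (\<lambda>x. w x ^ m)"
  by (induction m) (auto simp: cob_one intro: cob_mult)

lemma cob_self:
  assumes "continuous_on UNIV w" "\<And>x. norm (w x) = 1"
  shows "cob (\<lambda>x. w (S x) * cnj (w x))"
  unfolding cob_def using assms measurable_cont by (intro bexI[of _ w]) auto

lemma cob_iterate:
  assumes v: "continuous_on UNIV v" "\<And>x. norm (v x) = 1"
  shows "cob (\<lambda>x. v ((S ^^ h) x) * cnj (v x))"
proof (induction h)
  case 0
  then show ?case using cob_one unimodular_mult_cnj[OF v(2)] by simp
next
  case (Suc h)
  have "cob (\<lambda>x. v ((S ^^ h) (S x)) * cnj (v ((S ^^ h) x)))"
    using v by (intro cob_self comp_Sn_cont) auto
  from cob_mult[OF this Suc] show ?case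
  proof (rule back_subst[of cob], intro ext)
    fix x
    have "cnj (v ((S ^^ h) x)) * v ((S ^^ h) x) = 1" by (rule unimodular_cnj_mult[OF v(2)])
    then show "v ((S ^^ h) (S x)) * cnj (v ((S ^^ h) x)) * (v ((S ^^ h) x) * cnj (v x)) = v ((S ^^ Suc h) x) * cnj (v x)"
      by (simp add: funpow_swap1 mult.assoc)
  qed
qed

text \<open>Modulo coboundaries, v \<circ> S equals v, so the cocycle over a block of length h equals
  the power of v with exponent h.\<close>

lemma cob_cocyc_power:
  assumes v: "continuous_on UNIV v" "\<And>x. norm (v x) = 1"
  shows "cob (\<lambda>x. cocyc S v h x * cnj (v x ^ h))"
proof (induction h)
  case 0 then show ?case by (simp add: cob_one)
next
  case (Suc h)
  show ?case using cob_mult[OF Suc cob_iterate[OF v, of h]] by (simp add: cocyc_Suc mult_ac)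
qed

text \<open>The cocycle over h steps and the h-th power of v differ by a coboundary factor. So
  having no power that is a coboundary passes from v to its block cocycles, and having one does so
  as well for suitable lengths.\<close>

lemma cob_cocyc_iff:
  assumes v: "continuous_on UNIV v" "\<And>x. norm (v x) = 1"
  shows "cob (\<lambda>x. cocyc S v h x ^ m) \<longleftrightarrow> cob (\<lambda>x. v x ^ (h * m))"
proof -
  have b: "cob (\<lambda>x. (cocyc S v h x * cnj (v x ^ h)) ^ m)" by (rule cob_power[OF cob_cocyc_power[OF v]])
  have a1: "v x ^ (h*m) * cnj (v x ^ (h*m)) = 1" for x
    by (rule unimodular_mult_cnj) (simp add: norm_power v)
  have a2: "cocyc S v h x ^ m * cnj (cocyc S v h x ^ m) = 1" for x
    by (rule unimodular_mult_cnj) (simp add: norm_power norm_cocyc[OF v(2)])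
  have e1: "(cocyc S v h x * cnj (v x ^ h)) ^ m * v x ^ (h*m) = cocyc S v h x ^ m" for x
    using a1[of x] by (simp add: power_mult_distrib power_mult mult_ac)
  have e2: "cocyc S v h x ^ m * cnj ((cocyc S v h x * cnj (v x ^ h)) ^ m) = v x ^ (h*m)" for x
    using a2[of x] by (simp add: power_mult_distrib power_mult mult.assoc[symmetric])
  show ?thesis
    using cob_mult[OF b, of "\<lambda>x. v x ^ (h*m)"] cob_mult[OF _ cob_cnj[OF b], of "\<lambda>x. cocyc S v h x ^ m"]
    unfolding e1 e2 by blast
qed

lemma cocyc_continuous:
  assumes "continuous_on UNIV v"
  shows "continuous_on UNIV (cocyc S v h)"
  unfolding cocyc_def[abs_def] by (intro continuous_on_prod comp_Sn_cont assms)

text \<open>With one difference, u is \<open>u 0\<close> times the cocycle, so uniformity over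
  phases is uniformity over x. The equation in \<open>hyp\<close> says that \<phi> is fixed by the
  twisted operator.\<close>

lemma unif0_seqs_1:
  assumes v: "continuous_on UNIV v" "\<And>x. norm (v x) = 1" and f: "continuous_on UNIV f"
    and hyp: "\<And>\<phi>. \<phi> \<in> borel_measurable \<mu> \<Longrightarrow> (\<And>x. norm (\<phi> x) = 1) \<Longrightarrow>
      (AE x in \<mu>. \<phi> (S x) * cnj (\<phi> x) = cnj (v x)) \<Longrightarrow> (\<integral>x. f x * cnj (\<phi> x) \<partial>\<mu>) = 0"
  shows "unif0 (seqs (Suc 0) S v f)"
  unfolding unif0_def
proof (intro allI impI)
  fix \<epsilon> :: real assume e: "\<epsilon> > 0"
  obtain B where B: "\<And>x. norm (f x) \<le> B" using continuous_bounded_on_compact[OF cpt f] by blast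
  interpret twisted_system S \<mu> v f B
    by unfold_locales (use v f B in auto)
  obtain N0 where N0: "\<forall>N\<ge>N0. \<forall>x. norm (\<Sum>n<N. cocyc S v n x * f ((S ^^ n) x)) \<le> \<epsilon> * real N"
    using uniform_twisted[OF hyp e] by blast
  show "\<exists>N0. \<forall>N\<ge>N0. \<forall>a\<in>seqs (Suc 0) S v f. norm (sum a {..<N}) \<le> \<epsilon> * real N"
  proof (intro exI[of _ N0] allI impI ballI)
    fix N a assume N: "N0 \<le> N" and "a \<in> seqs (Suc 0) S v f"
    then obtain x u where a: "a = (\<lambda>n. u n * f ((S ^^ n) x))" "orb (Suc 0) S v x u" unfolding seqs_def by blast
    have u1: "norm (u n) = 1" for n using a(2) unfolding orb_def by simp
    have "u n = u 0 * cocyc S v n x" for n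
    proof (induction n)
      case (Suc n)
      have "u (Suc n) * cnj (u n) = v ((S ^^ n) x)" using a(2) unfolding orb_def by (simp add: dif_def)
      then have "u (Suc n) = v ((S ^^ n) x) * u n"
        using unimodular_cnj_mult[OF u1[of n]] by (metis mult.assoc mult.right_neutral)
      then show ?case using Suc by (simp add: cocyc_Suc mult_ac)
    qed simp
    then have "(\<Sum>n<N. a n) = u 0 * (\<Sum>n<N. cocyc S v n x * f ((S ^^ n) x))"
      unfolding a sum_distrib_left by (intro sum.cong refl) (metis mult.assoc)
    then show "norm (sum a {..<N}) \<le> \<epsilon> * real N" using N0 N u1[of 0] by (simp add: norm_mult)
  qed
qed

text \<open>At the base a \<phi> as in \<open>unif0_seqs_1\<close> would make v a coboundary, so the
  estimate holds for every continuous f. This generality lets van der Corput's step replace f by its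
  correlations.\<close>

lemma unif0_seqs_no_coboundary:
  assumes "continuous_on UNIV v" "\<And>x. norm (v x) = 1"
    and "\<And>m. m \<ge> 1 \<Longrightarrow> \<not> cob (\<lambda>x. v x ^ m)" and "continuous_on UNIV f"
  shows "unif0 (seqs (Suc l) S v f)"
  using assms
proof (induction l arbitrary: v f)
  case 0
  show ?case
  proof (rule unif0_seqs_1)
    fix \<phi> assume p: "\<phi> \<in> borel_measurable \<mu>" "\<And>x. norm (\<phi> x) = 1" "AE x in \<mu>. \<phi> (S x) * cnj (\<phi> x) = cnj (v x)"
    then have "cob (\<lambda>x. cnj (v x))" unfolding cob_def by blast
    from cob_cnj[OF this] have "cob (\<lambda>x. v x ^ 1)" by simp
    then show "(\<integral>x. f x * cnj (\<phi> x) \<partial>\<mu>) = 0" using 0(3)[of 1] by simp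
  qed (use 0 in auto)
next
  case (Suc l)
  obtain B where B: "\<And>x. norm (f x) \<le> B" using continuous_bounded_on_compact[OF cpt Suc.prems(4)] by blast
  show ?case
  proof (rule unif0_seqs_van_der_Corput[OF B])
    fix h :: nat assume h: "h \<ge> 1"
    show "unif0 (seqs (Suc l) S (cocyc S v h) (\<lambda>x. f ((S ^^ h) x) * cnj (f x)))"
    proof (rule Suc.IH)
      show "\<not> cob (\<lambda>x. cocyc S v h x ^ m)" if "m \<ge> 1" for m
        unfolding cob_cocyc_iff[OF Suc.prems(1,2)] using Suc.prems(3)[of "h*m"] h that by simp
      show "continuous_on UNIV (\<lambda>x. f ((S ^^ h) x) * cnj (f x))"
        by (intro continuous_intros comp_Sn_cont Suc.prems)
    qed (use norm_cocyc[OF Suc.prems(2)] cocyc_continuous[OF Suc.prems(1)] in auto)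
  qed
qed

end

section \<open>Quasi-eigenfunctions and polynomial phases\<close>

text \<open>Level 0 admits every unimodular constant, not only eigenvalues; from level 1 on this makes no
  difference, since h itself witnesses that a constant \<open>(h \<circ> T) / h\<close> is an eigenvalue.\<close>

fun Kfun :: "('a::topological_space \<Rightarrow> 'a) \<Rightarrow> nat \<Rightarrow> ('a \<Rightarrow> complex) set" where
  "Kfun T 0 = {\<lambda>_. c |c. norm c = 1}"
| "Kfun T (Suc j) = {h. continuous_on UNIV h \<and> (\<forall>x. norm (h x) = 1) \<and>
      (\<lambda>x. h (T x) * cnj (h x)) \<in> Kfun T j}"

lemma Kfun_norm: "h \<in> Kfun T j \<Longrightarrow> norm (h x) = 1"
  by (cases j) auto

lemma Kfun_continuous: "h \<in> Kfun T j \<Longrightarrow> continuous_on UNIV h"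
  by (cases j) auto

lemma Kfun_const: "norm c = 1 \<Longrightarrow> (\<lambda>_. c) \<in> Kfun T j"
  by (induction j arbitrary: c) (auto simp: unimodular_mult_cnj)

lemma Kfun_mult: "h \<in> Kfun T j \<Longrightarrow> g \<in> Kfun T j \<Longrightarrow> (\<lambda>x. h x * g x) \<in> Kfun T j"
proof (induction j arbitrary: h g)
  case 0
  then obtain c d where "h = (\<lambda>_. c)" "g = (\<lambda>_. d)" "norm c = 1" "norm d = 1" by auto
  then show ?case by (auto simp: norm_mult intro!: exI[of _ "c * d"])
next
  case (Suc j)
  have "(\<lambda>x. (h (T x) * cnj (h x)) * (g (T x) * cnj (g x))) \<in> Kfun T j"
    using Suc by auto
  moreover have "(\<lambda>x. (h (T x) * cnj (h x)) * (g (T x) * cnj (g x))) = (\<lambda>x. (h (T x) * g (T x)) * cnj (h x * g x))"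
    by (simp add: fun_eq_iff mult_ac)
  ultimately show ?case using Suc.prems by (auto simp: norm_mult intro!: continuous_intros)
qed

lemma Kfun_cnj: "h \<in> Kfun T j \<Longrightarrow> (\<lambda>x. cnj (h x)) \<in> Kfun T j"
proof (induction j arbitrary: h)
  case 0
  then obtain c where "h = (\<lambda>_. c)" "norm c = 1" by auto
  then show ?case by (auto intro!: exI[of _ "cnj c"])
next
  case (Suc j)
  then have "(\<lambda>x. h (T x) * cnj (h x)) \<in> Kfun T j" by simp
  from Suc.IH[OF this] show ?case using Suc.prems by (auto intro!: continuous_intros)
qed

lemma Kfun_comp:
  assumes T: "continuous_on UNIV T"
  shows "h \<in> Kfun T j \<Longrightarrow> (\<lambda>x. h (T x)) \<in> Kfun T j"
proof (induction j arbitrary: h)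
  case (Suc j)
  then have "(\<lambda>x. h (T (T x)) * cnj (h (T x))) \<in> Kfun T j"
    using Suc.IH[of "\<lambda>x. h (T x) * cnj (h x)"] by auto
  then show ?case using Suc.prems continuous_on_compose2[OF _ T, of UNIV h] by auto
qed auto

lemma Kfun_comp_funpow:
  assumes T: "continuous_on UNIV T"
  shows "h \<in> Kfun T j \<Longrightarrow> (\<lambda>x. h ((T ^^ n) x)) \<in> Kfun T j"
proof (induction n)
  case (Suc n)
  then show ?case using Kfun_comp[OF T, of "\<lambda>x. h ((T ^^ n) x)" j] by (simp add: funpow_swap1)
qed simp

text \<open>Subsampling preserves the order j: the block cocycles that replace v are products of
  translates of v.\<close>

lemma Kfun_cocyc:
  assumes T: "continuous_on UNIV T" and h: "h \<in> Kfun T j"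
  shows "cocyc (T ^^ M) h m \<in> Kfun T j"
proof (induction m)
  case 0
  then show ?case using Kfun_const[of 1 T j] by (simp add: cocyc_def[abs_def])
next
  case (Suc m)
  have "(\<lambda>x. h (((T ^^ M) ^^ m) x)) \<in> Kfun T j"
    using Kfun_comp_funpow[OF T h, of "M * m"] by (simp add: funpow_mult)
  from Kfun_mult[OF Suc this] show ?case by (simp add: cocyc_Suc[abs_def])
qed

lemma Gfun_subset_Kfun: "Gfun T (Suc j) \<subseteq> Kfun T (Suc j)"
proof (induction j)
  case 0
  show ?case
  proof
    fix h assume h: "h \<in> Gfun T (Suc 0)"
    then obtain c where c: "(\<lambda>x. h (T x) * cnj (h x)) = (\<lambda>_. c)" and n: "\<And>x. norm (h x) = 1" by auto
    have "norm c = norm (h (T undefined) * cnj (h undefined))" using fun_cong[OF c, of undefined] by simp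
    then have "norm c = 1" using n by (simp add: norm_mult)
    then show "h \<in> Kfun T (Suc 0)" using h c by auto
  qed
next
  case (Suc j)
  then show ?case by auto
qed

text \<open>Read along an orbit, the difference of h is the function one level below read along the
  same orbit.\<close>

lemma Kfun_dif_const: "h \<in> Kfun T j \<Longrightarrow> \<exists>c. norm c = 1 \<and> (\<forall>n. (dif ^^ j) (\<lambda>n. h ((T ^^ n) x)) n = c)"
proof (induction j arbitrary: h)
  case (Suc j)
  have "dif (\<lambda>n. h ((T ^^ n) x)) = (\<lambda>n. h (T ((T ^^ n) x)) * cnj (h ((T ^^ n) x)))"
    by (simp add: dif_def fun_eq_iff)
  then show ?case using Suc.IH[of "\<lambda>x. h (T x) * cnj (h x)"] Suc.prems
    by (simp add: funpow_Suc_right del: funpow.simps)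
qed auto

section \<open>Polynomial phases as sequences with trivial iterated difference\<close>

lemma binomial_poly: "\<exists>p::real poly. degree p \<le> j \<and> (\<forall>n. poly p (real n) = real (n choose j))"
proof -
  define p :: "real poly" where "p = smult (1 / fact j) (\<Prod>i<j. [:- real i, 1:])"
  have "degree (\<Prod>i<j. [:- real i, 1:]) \<le> (\<Sum>i<j. degree [:- real i, 1:])"
    using degree_prod_sum_le[of "{..<j}" "\<lambda>i. [:- real i, 1:]"] by (simp add: comp_def)
  then have "degree p \<le> j" unfolding p_def by (intro order_trans[OF degree_smult_le]) simp
  moreover have "poly p (real n) = real (n choose j)" for n
    unfolding p_def by (simp add: poly_prod binomial_gbinomial gbinomial_prod_rev atLeast0LessThan)
  ultimately show ?thesis by blast
qed

lemma unimodular_eq_exp: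
  assumes "norm (z::complex) = 1"
  obtains t :: real where "z = exp (2 * pi * \<i> * complex_of_real t)"
proof -
  have "z = exp (\<i> * of_real (Arg z))" using assms rcis_cmod_Arg[of z] by (simp add: rcis_def cis_conv_exp)
  then show ?thesis using that[of "Arg z / (2 * pi)"] by (simp add: mult_ac)
qed

text \<open>Newton interpolation, with the binomial coefficients as basis.\<close>

lemma dif_trivial_imp_poly_phase:
  assumes "\<And>n. norm (u n) = 1" "(dif ^^ Suc k) u = (\<lambda>_. 1)"
  shows "\<exists>p::real poly. degree p \<le> k \<and> (\<forall>n. u n = exp (2 * pi * \<i> * complex_of_real (poly p (real n))))"
proof -
  have "\<exists>\<theta>. \<forall>n. u n = exp (2 * pi * \<i> * complex_of_real (\<Sum>j\<le>k. \<theta> j * real (n choose j)))"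
    using assms
  proof (induction k arbitrary: u)
    case 0
    obtain t where t: "u 0 = exp (2 * pi * \<i> * complex_of_real t)" using unimodular_eq_exp[OF 0(1)] .
    have "u (Suc n) = u n" for n
    proof -
      have "u (Suc n) * cnj (u n) = 1" using fun_cong[OF 0(2), of n] by (simp add: dif_def)
      then show ?thesis using unimodular_cnj_mult[OF 0(1)[of n]] by (metis mult.assoc mult.right_neutral mult.left_neutral)
    qed
    then have "u n = u 0" for n by (induction n) auto
    then show ?case using t by (intro exI[of _ "\<lambda>_. t"]) simp
  next
    case (Suc k)
    note u1 = Suc.prems(1)
    have "norm (dif u n) = 1" for n using u1 by (simp add: dif_def norm_mult)
    moreover have "(dif ^^ Suc k) (dif u) = (\<lambda>_. 1)"
      using Suc.prems(2) by (subst (asm) funpow_Suc_right) (simp del: funpow.simps)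
    ultimately obtain \<theta> where th: "\<And>n. dif u n = exp (2 * pi * \<i> * complex_of_real (\<Sum>j\<le>k. \<theta> j * real (n choose j)))"
      using Suc.IH by blast
    obtain t where t: "u 0 = exp (2 * pi * \<i> * complex_of_real t)" using unimodular_eq_exp[OF Suc.prems(1)] .
    define \<eta> where "\<eta> j = (case j of 0 \<Rightarrow> t | Suc i \<Rightarrow> \<theta> i)" for j
    define s where "s n = (\<Sum>j\<le>Suc k. \<eta> j * real (n choose j))" for n
    have s_alt: "s n = t + (\<Sum>j\<le>k. \<theta> j * real (n choose Suc j))" for n
      unfolding s_def sum.atMost_Suc_shift by (simp add: \<eta>_def)
    have "u n = exp (2 * pi * \<i> * complex_of_real (s n))" for n
    proof (induction n)
      case 0 then show ?case using t by (simp add: s_alt)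
    next
      case (Suc n)
      have "u (Suc n) = dif u n * u n"
        using unimodular_cnj_mult[OF u1[of n]] unfolding dif_def
        by (simp add: mult.assoc)
      moreover have "s (Suc n) = (\<Sum>j\<le>k. \<theta> j * real (n choose j)) + s n"
        unfolding s_alt by (simp add: sum.distrib distrib_left)
      ultimately show ?case using Suc.IH th[of n] by (simp add: exp_add[symmetric] distrib_left)
    qed
    then show ?case unfolding s_def by blast
  qed
  then obtain \<theta> where th: "\<And>n. u n = exp (2 * pi * \<i> * complex_of_real (\<Sum>j\<le>k. \<theta> j * real (n choose j)))" by blast
  obtain q :: "nat \<Rightarrow> real poly" where q: "\<And>j. degree (q j) \<le> j" "\<And>j n. poly (q j) (real n) = real (n choose j)"
    using binomial_poly by metis
  define p where "p = (\<Sum>j\<le>k. smult (\<theta> j) (q j))"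
  have "degree p \<le> k" unfolding p_def
    by (intro degree_sum_le) (auto intro: order_trans[OF degree_smult_le] order_trans[OF q(1)])
  moreover have "poly p (real n) = (\<Sum>j\<le>k. \<theta> j * real (n choose j))" for n
    unfolding p_def by (simp add: poly_sum q)
  ultimately show ?thesis using th by metis
qed

text \<open>The polynomial is p(t + 1) - p(t), and the two leading coefficients cancel.\<close>

lemma degree_forward_difference:
  fixes p :: "real poly"
  assumes "degree p \<le> Suc k"
  shows "degree (pcompose p [:1, 1:] - p) \<le> k"
proof (rule degree_le, intro allI impI)
  fix i assume i: "k < i"
  have d: "degree (pcompose p [:1, 1:]) = degree p" by (simp add: degree_pcompose)
  show "coeff (pcompose p [:1, 1:] - p) i = 0"
  proof (cases "degree p = i")
    case True
    have "lead_coeff (pcompose p [:1, 1:]) = lead_coeff p * lead_coeff [:1, 1:] ^ degree p"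
      by (rule lead_coeff_comp) simp
    then show ?thesis using True d by simp
  next
    case False
    then have "degree p < i" using assms i by simp
    then show ?thesis using d by (simp add: coeff_eq_0)
  qed
qed

lemma poly_phase_dif_trivial:
  fixes p :: "real poly"
  assumes "degree p \<le> k"
  shows "(dif ^^ Suc k) (\<lambda>n. exp (2 * pi * \<i> * complex_of_real (poly p (real n)))) = (\<lambda>_. 1)"
proof -
  have dif_poly: "dif (\<lambda>n. exp (2 * pi * \<i> * complex_of_real (poly p (real n))))
     = (\<lambda>n. exp (2 * pi * \<i> * complex_of_real (poly (pcompose p [:1,1:] - p) (real n))))" for p :: "real poly"
    by (simp add: dif_def fun_eq_iff exp_cnj exp_add[symmetric] poly_pcompose algebra_simps)
  show ?thesis using assms
  proof (induction k arbitrary: p)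
    case 0
    then obtain a where "p = [:a:]" by (auto elim: degree_eq_zeroE)
    then show ?case using dif_poly[of p] by simp
  next
    case (Suc k)
    show ?case using Suc.IH[OF degree_forward_difference[OF Suc.prems]]
      by (subst funpow_Suc_right) (simp only: comp_apply dif_poly)
  qed
qed

lemma norm_poly_phase: "norm (exp (2 * pi * \<i> * complex_of_real t)) = 1"
  by (simp add: norm_exp_eq_Re)

section \<open>Powers of T, full support and the induction on the number of differences\<close>

locale totally_strictly_ergodic =
  fixes T :: "'a::metric_space \<Rightarrow> 'a" and \<mu> :: "'a measure"
  assumes cpt_space: "compact (UNIV :: 'a set)" and T_cont: "continuous_on UNIV T"
    and se: "\<And>j. j \<ge> 1 \<Longrightarrow> strictly_ergodic (T ^^ j)"
    and invT: "invariant_prob T \<mu>"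
begin

text \<open>\<mu> is invariant under every power, hence is the unique invariant measure of each, and
  the results for \<open>ue_system\<close> apply to all powers with the same \<mu>.\<close>

lemma ue_powers:
  assumes "M \<ge> 1"
  shows "ue_system (T ^^ M) \<mu>"
proof
  have sets: "sets \<mu> = sets borel" and p: "prob_space \<mu>" and d: "distr \<mu> \<mu> T = \<mu>"
    using invT unfolding invariant_prob_def by auto
  have m: "S \<in> measurable \<mu> \<mu>" if "continuous_on UNIV S" for S :: "'a \<Rightarrow> 'a"
    using borel_measurable_continuous_onI[OF that] sets by (metis measurable_cong_sets)
  have "distr \<mu> \<mu> (T ^^ n) = \<mu>" for n
  proof (induction n)
    case 0 then show ?case by (simp add: id_def distr_id)
  next
    case (Suc n)
    have "distr (distr \<mu> \<mu> (T ^^ n)) \<mu> T = distr \<mu> \<mu> (T \<circ> (T ^^ n))"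
      using m[OF T_cont] m[OF funpow_continuous_on[OF T_cont]] by (rule distr_distr)
    then show ?case unfolding Suc d funpow.simps(2) by (rule sym)
  qed
  then show "invariant_prob (T ^^ M) \<mu>" unfolding invariant_prob_def using sets p by simp
  show "uniquely_ergodic (T ^^ M)" using se[OF assms] unfolding strictly_ergodic_def by simp
qed (use cpt_space funpow_continuous_on[OF T_cont] in auto)

sublocale T: ue_system T \<mu>
  using ue_powers[of 1] by simp

lemma minT: "minimal_map T"
  using se[of 1] unfolding strictly_ergodic_def by simp

text \<open>The points whose orbit never meets U form a closed forward invariant set. If U is null,
  almost every point belongs to it, so by minimality it is the whole space.\<close>

lemma open_null_imp_empty:
  assumes U: "open U" and null: "emeasure \<mu> U = 0"
  shows "U = {}"
proof -
  define A where "A = - (\<Union>n. (T ^^ n) -` U)"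
  have "closed A" unfolding A_def
    using U funpow_continuous_on[OF T_cont] by (auto intro!: open_vimage)
  moreover have "T ` A \<subseteq> A"
  proof (rule image_subsetI)
    fix x assume "x \<in> A"
    then have "(T ^^ Suc n) x \<notin> U" for n unfolding A_def by blast
    then show "T x \<in> A" unfolding A_def by (simp add: funpow_swap1)
  qed
  ultimately have "A = {} \<or> A = UNIV" using minT unfolding minimal_map_def by blast
  moreover have "A \<noteq> {}"
  proof
    assume "A = {}"
    have "AE x in \<mu>. x \<notin> U" using U null by (intro AE_not_in) (simp add: null_setsI)
    then have "AE x in \<mu>. \<forall>n. (T ^^ n) x \<notin> U" unfolding AE_all_countable using T.AE_Sn[of "\<lambda>x. x \<notin> U"] by blast
    then have "AE x in \<mu>. False"
    proof eventually_elim
      case (elim x)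
      then have "x \<in> A" unfolding A_def by auto
      with \<open>A = {}\<close> show ?case by simp
    qed
    then show False using T.AE_False by simp
  qed
  ultimately have "A = UNIV" by simp
  then have "(T ^^ 0) x \<notin> U" for x unfolding A_def by blast
  then show ?thesis by auto
qed

lemma AE_eq_continuous_imp_eq:
  fixes g h :: "'a \<Rightarrow> complex"
  assumes "continuous_on UNIV g" "continuous_on UNIV h" "AE x in \<mu>. g x = h x"
  shows "g x = h x"
proof -
  define U where "U = {x. g x \<noteq> h x}"
  have U: "open U" unfolding U_def using assms by (intro open_Collect_neq)
  have "emeasure \<mu> U = 0"
    using assms(3) U by (subst (asm) AE_iff_measurable[of U]) (auto simp: U_def)
  then have "U = {}" by (rule open_null_imp_empty[OF U])
  then show ?thesis unfolding U_def by blast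
qed

lemma bounded_in_L2:
  assumes "h \<in> borel_measurable \<mu>" "\<And>x. norm (h x) = 1"
  shows "h \<in> L2 \<mu>"
  unfolding L2_def using assms by (simp add: T.integrable_const)

text \<open>The difference under T inherits the cocycle equation one level below; at level 0 it is
  invariant under the power, hence constant.\<close>

lemma quasi_eigenfunction_of_power:
  assumes M: "M \<ge> 1"
  shows "w \<in> Kfun T j \<Longrightarrow> \<phi> \<in> borel_measurable \<mu> \<Longrightarrow> (\<And>x. norm (\<phi> x) = 1) \<Longrightarrow>
    AE x in \<mu>. \<phi> ((T ^^ M) x) * cnj (\<phi> x) = w x \<Longrightarrow> \<phi> \<in> Efun \<mu> T (Suc j)"
proof (induction j arbitrary: w \<phi>)
  case 0
  interpret S: ue_system "T ^^ M" \<mu> by (rule ue_powers[OF M])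
  note [measurable] = 0(2)
  obtain c where c: "w = (\<lambda>_. c)" "norm c = 1" using 0 by auto
  define p where "p x = \<phi> (T x) * cnj (\<phi> x)" for x
  have pm [measurable]: "p \<in> borel_measurable \<mu>" unfolding p_def[abs_def] by measurable
  have p1: "norm (p x) = 1" for x unfolding p_def using 0(3) by (simp add: norm_mult)
  have e: "AE x in \<mu>. \<phi> ((T ^^ M) x) = c * \<phi> x"
    using 0(4)
  proof eventually_elim
    case (elim x)
    then show ?case using c(1) unimodular_cnj_mult[OF 0(3)[of x]] by (metis mult.assoc mult.right_neutral)
  qed
  have "AE x in \<mu>. p ((T ^^ M) x) = p x"
    using e T.AE_S[OF e]
  proof eventually_elim
    case (elim x)
    have "p ((T ^^ M) x) = (c * \<phi> (T x)) * cnj (c * \<phi> x)"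
      unfolding p_def elim(1) using elim(2) by (simp add: funpow_swap1)
    also have "\<dots> = (c * cnj c) * p x" unfolding p_def by (simp add: mult_ac)
    finally show ?case using unimodular_mult_cnj[OF c(2)] by simp
  qed
  \<comment> \<open>p is known to be invariant only under \<open>T ^^ M\<close>, so unique
    ergodicity of that power is what makes it constant.\<close>
  then obtain d where d: "AE x in \<mu>. p x = d"
    using S.invariant_complex_const[OF pm, of 1] p1 by auto
  have phL: "\<phi> \<in> L2 \<mu>" "p \<in> L2 \<mu>" using bounded_in_L2 0(2,3) pm p1 by auto
  have "AE x in \<mu>. \<phi> (T x) = d * \<phi> x"
    using d
  proof eventually_elim
    case (elim x)
    then show ?case unfolding p_def using unimodular_cnj_mult[OF 0(3)[of x]] by (metis mult.assoc mult.right_neutral)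
  qed
  moreover have "\<not> (AE x in \<mu>. \<phi> x = 0)"
  proof
    assume "AE x in \<mu>. \<phi> x = 0"
    then have "AE x in \<mu>. False"
    proof eventually_elim
      case (elim x)
      then show ?case using 0(3)[of x] by simp
    qed
    then show False using T.AE_False by simp
  qed
  ultimately have "d \<in> E0 \<mu> T" unfolding E0_def using phL by blast
  then have "p \<in> Efun \<mu> T 0" using phL d by auto
  then show ?case using phL 0(3) unfolding p_def[abs_def] by simp
next
  case (Suc j)
  note [measurable] = Suc.prems(2)
  define p where "p x = \<phi> (T x) * cnj (\<phi> x)" for x
  have pm [measurable]: "p \<in> borel_measurable \<mu>" unfolding p_def[abs_def] by measurable
  have p1: "norm (p x) = 1" for x unfolding p_def using Suc.prems(3) by (simp add: norm_mult)
  have "AE x in \<mu>. p ((T ^^ M) x) * cnj (p x) = w (T x) * cnj (w x)"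
    using Suc.prems(4) T.AE_S[OF Suc.prems(4)]
  proof eventually_elim
    case (elim x)
    show ?case unfolding p_def elim[symmetric] by (simp add: funpow_swap1 mult_ac)
  qed
  moreover have "(\<lambda>x. w (T x) * cnj (w x)) \<in> Kfun T j" using Suc.prems(1) by simp
  ultimately have "p \<in> Efun \<mu> T (Suc j)" using Suc.IH pm p1 by blast
  then show ?case using bounded_in_L2[OF Suc.prems(2,3)] Suc.prems(3) unfolding p_def[abs_def] by simp
qed

text \<open>The balance \<open>Suc l + j = k\<close> makes a fixed vector at l = 0 a
  quasi-eigenfunction of order exactly k, where orthogonality applies. M and v vary in the induction
  because each coboundary step passes to a higher power of T and raises j by one.\<close>

lemma unif0_seqs_orthogonal:
  assumes H2: "\<forall>j\<in>{1..k}. \<forall>h\<in>Efun \<mu> T j. \<exists>g\<in>Gfun T j. AE x in \<mu>. h x = g x"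
    and f: "continuous_on UNIV f"
    and orth: "\<forall>g\<in>Gfun T k. (\<integral>x. f x * cnj (g x) \<partial>\<mu>) = 0"
  shows "Suc l + j = k \<Longrightarrow> M \<ge> 1 \<Longrightarrow> v \<in> Kfun T j \<Longrightarrow> unif0 (seqs (Suc l) (T ^^ M) v f)"
proof (induction l arbitrary: j M v)
  case 0
  interpret S: ue_system "T ^^ M" \<mu> by (rule ue_powers[OF 0(2)])
  show ?case
  proof (rule S.unif0_seqs_1[OF Kfun_continuous[OF 0(3)] Kfun_norm[OF 0(3)] f])
    fix \<phi> assume p: "\<phi> \<in> borel_measurable \<mu>" "\<And>x. norm (\<phi> x) = 1"
      "AE x in \<mu>. \<phi> ((T ^^ M) x) * cnj (\<phi> x) = cnj (v x)"
    have "\<phi> \<in> Efun \<mu> T (Suc j)"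
      by (rule quasi_eigenfunction_of_power[OF 0(2) Kfun_cnj[OF 0(3)] p])
    then obtain g where g: "g \<in> Gfun T k" "AE x in \<mu>. \<phi> x = g x" using H2 0(1) by fastforce
    have gK: "g \<in> Kfun T (Suc j)" using g(1) 0(1) Gfun_subset_Kfun[of T j] by auto
    have [measurable]: "f \<in> borel_measurable \<mu>" "g \<in> borel_measurable \<mu>" "\<phi> \<in> borel_measurable \<mu>"
      using T.measurable_cont f Kfun_continuous[OF gK] p by auto
    have "(\<integral>x. f x * cnj (\<phi> x) \<partial>\<mu>) = (\<integral>x. f x * cnj (g x) \<partial>\<mu>)"
    proof (rule integral_cong_AE)
      show "AE x in \<mu>. f x * cnj (\<phi> x) = f x * cnj (g x)" using g(2) by eventually_elim simp
    qed measurable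
    then show "(\<integral>x. f x * cnj (\<phi> x) \<partial>\<mu>) = 0" using orth g(1) by simp
  qed
next
  case (Suc l)
  define S where "S = T ^^ M"
  interpret S: ue_system S \<mu> unfolding S_def by (rule ue_powers[OF Suc.prems(2)])
  note vc = Kfun_continuous[OF Suc.prems(3)] and v1 = Kfun_norm[OF Suc.prems(3)]
  obtain B where "B \<ge> 0" and B: "\<And>x. norm (f x) \<le> B" by (rule continuous_bounded_on_compact[OF cpt_space f], rule that)
  show ?case unfolding S_def[symmetric]
  proof (cases "\<exists>m\<ge>1. S.cob (\<lambda>x. v x ^ m)")
    case False
    then show "unif0 (seqs (Suc (Suc l)) S v f)"
      using S.unif0_seqs_no_coboundary[OF vc v1 _ f] by blast
  next
    case True
    then obtain m where m: "m \<ge> 1" "S.cob (\<lambda>x. v x ^ m)" by blast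
    \<comment> \<open>The functions by which subsampling with step m replaces v. Modulo coboundaries
      V i is v to the power m^i, so it is a coboundary from i = 1 on.\<close>
    define V where "V i = ((\<lambda>w. cocyc S w m) ^^ i) v" for i
    have VK: "V i \<in> Kfun T j" for i
      unfolding V_def S_def by (induction i) (auto intro: Kfun_cocyc[OF T_cont] Suc.prems(3))
    have V1: "S.cob (V (Suc i))" for i
    proof (induction i)
      case 0
      show ?case using S.cob_cocyc_iff[OF vc v1, of m 1] m(2) by (simp add: V_def)
    next
      case (Suc i)
      have "S.cob (\<lambda>x. V (Suc i) x ^ (m * 1))" using S.cob_power[OF Suc] by simp
      then have "S.cob (\<lambda>x. cocyc S (V (Suc i)) m x ^ 1)"
        using S.cob_cocyc_iff[OF Kfun_continuous[OF VK] Kfun_norm[OF VK]] by blast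
      then show ?case by (simp add: V_def)
    qed
    obtain \<phi> where p: "\<phi> \<in> borel_measurable \<mu>" "\<And>x. norm (\<phi> x) = 1"
      "AE x in \<mu>. \<phi> (S x) * cnj (\<phi> x) = V (Suc l) x"
      using V1[of l] unfolding S.cob_def by blast
    have "\<phi> \<in> Efun \<mu> T (Suc j)"
      by (rule quasi_eigenfunction_of_power[OF Suc.prems(2) VK p[unfolded S_def]])
    moreover have "Suc j \<in> {1..k}" using Suc.prems(1) by simp
    ultimately obtain \<psi> where g: "\<psi> \<in> Gfun T (Suc j)" "AE x in \<mu>. \<phi> x = \<psi> x" using H2 by blast
    have psiK: "\<psi> \<in> Kfun T (Suc j)" using g(1) Gfun_subset_Kfun[of T j] by auto
    note pc = Kfun_continuous[OF psiK] and p1 = Kfun_norm[OF psiK]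
    have "AE x in \<mu>. \<psi> (S x) * cnj (\<psi> x) = V (Suc l) x"
      using p(3) g(2) S.AE_S[OF g(2)] by eventually_elim simp
    \<comment> \<open>Both sides are continuous and \<mu> has full support, so the equation holds at
      every point of every orbit.\<close>
    then have e1: "\<psi> (S x) * cnj (\<psi> x) = V (Suc l) x" for x
    proof (rule AE_eq_continuous_imp_eq[rotated 2])
      show "continuous_on UNIV (\<lambda>x. \<psi> (S x) * cnj (\<psi> x))"
        using S.comp_Sn_cont[OF pc, of 1] pc by (auto intro!: continuous_intros)
    qed (rule Kfun_continuous[OF VK])
    have e2: "cocyc S (V (Suc l)) n x = \<psi> ((S ^^ n) x) * cnj (\<psi> x)" for n x
    proof (induction n)
      case 0 then show ?case using unimodular_mult_cnj[OF p1] by simp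
    next
      case (Suc n)
      have "cocyc S (V (Suc l)) (Suc n) x
        = (\<psi> ((S ^^ n) x) * cnj (\<psi> x)) * (\<psi> (S ((S ^^ n) x)) * cnj (\<psi> ((S ^^ n) x)))"
        by (simp only: cocyc_Suc Suc e1)
      also have "\<dots> = \<psi> ((S ^^ Suc n) x) * cnj (\<psi> x) * (cnj (\<psi> ((S ^^ n) x)) * \<psi> ((S ^^ n) x))"
        by (simp add: mult_ac)
      finally show ?case unfolding unimodular_cnj_mult[OF p1] by simp
    qed
    \<comment> \<open>Subsampling l + 2 differences requires V (l + 2), the block cocycle of V (l +
      1). As V (l + 1) is the coboundary of \<psi> over S, V (l + 2) is that of the same \<psi> over
      \<open>S ^^ m\<close>.\<close>
    have "unif0 (seqs (Suc (Suc l)) (S ^^ m) (V (Suc (Suc l))) f)"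
    proof (rule unif0_seqs_coboundary[OF B p1])
      show "V (Suc (Suc l)) x = \<psi> ((S ^^ m) x) * cnj (\<psi> x)" for x
        using e2[of m x] by (simp add: V_def)
      fix r :: complex assume r: "norm r = 1"
      have "(\<lambda>x. r * \<psi> x) \<in> Kfun T (Suc j)" by (rule Kfun_mult[OF Kfun_const[OF r] psiK])
      then have "unif0 (seqs (Suc l) (T ^^ (M * m)) (\<lambda>x. r * \<psi> x) f)"
        using Suc.prems m(1) by (intro Suc.IH[of "Suc j"]) auto
      then show "unif0 (seqs (Suc l) (S ^^ m) (\<lambda>x. r * \<psi> x) f)"
        unfolding S_def by (simp add: funpow_mult)
    qed
    then show "unif0 (seqs (Suc (Suc l)) S v f)"
      unfolding V_def by (rule unif0_seqs_subsample[OF B m(1)])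
  qed
qed

end

theorem theoremA:
  fixes T :: "'a::metric_space \<Rightarrow> 'a" and \<mu> :: "'a measure" and k :: nat
  assumes "compact (UNIV :: 'a set)"
    and "continuous_on UNIV T"
    and "k \<ge> 1"
    and H1: "\<forall>j\<ge>1. strictly_ergodic (T ^^ j)"
    and mu: "invariant_prob T \<mu>"
    and H2a: "E0 \<mu> T = G0 T"
    and H2b: "\<forall>j\<in>{1..k}. \<forall>h\<in>Efun \<mu> T j. \<exists>g\<in>Gfun T j. AE x in \<mu>. h x = g x"
    and "continuous_on UNIV f"
  shows "(\<forall>g\<in>Gfun T k. (\<integral>x. f x * cnj (g x) \<partial>\<mu>) = 0) \<longleftrightarrow>
         (\<forall>x. (\<lambda>N. SUP P\<in>{P :: real poly. degree P \<le> k}.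
                 norm ((1 / of_nat N) * (\<Sum>n<N. exp (2 * pi * \<i> * complex_of_real (poly P (real n)))
                        * f ((T ^^ n) x))))
               \<longlonglongrightarrow> 0)"
proof -
  interpret totally_strictly_ergodic T \<mu>
    by unfold_locales (use assms in auto)
  note f = assms(8)
  obtain B where B: "\<And>x. norm (f x) \<le> B" using continuous_bounded_on_compact[OF assms(1) f] by blast
  have B0: "0 \<le> B" using order_trans[OF norm_ge_zero B] .
  define e where "e P n = exp (2 * pi * \<i> * complex_of_real (poly P (real n)))" for P :: "real poly" and n
  have e1: "norm (e P n) = 1" for P n unfolding e_def by (rule norm_poly_phase)
  define D where "D = {P :: real poly. degree P \<le> k}"
  have D0: "0 \<in> D" unfolding D_def by simp
  define F where "F x N P = norm ((1 / of_nat N) * (\<Sum>n<N. e P n * f ((T ^^ n) x)))" for x and N :: nat and P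
  have FB: "F x N P \<le> B" for x N P
  proof (cases "N = 0")
    case False
    have "norm (\<Sum>n<N. e P n * f ((T ^^ n) x)) \<le> (\<Sum>n<N. B)"
      by (intro sum_norm_le) (simp add: norm_mult e1 B)
    then show ?thesis using False unfolding F_def by (simp add: norm_mult norm_divide divide_simps mult.commute)
  qed (simp add: F_def B0)
  \<comment> \<open>A real \<open>SUP\<close> controls its terms only over a bounded set; the phases
    being unimodular, B bounds them all.\<close>
  have bdd: "bdd_above (F x N ` D)" for x N using FB by (intro bdd_aboveI[of _ B]) auto
  have F_nonneg: "0 \<le> F x N P" for x N P unfolding F_def by simp
  have "(\<forall>g\<in>Gfun T k. (\<integral>x. f x * cnj (g x) \<partial>\<mu>) = 0) \<longleftrightarrow> (\<forall>x. (\<lambda>N. SUP P\<in>D. F x N P) \<longlonglongrightarrow> 0)"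
  proof
    assume orth: "\<forall>g\<in>Gfun T k. (\<integral>x. f x * cnj (g x) \<partial>\<mu>) = 0"
    \<comment> \<open>Polynomial phases need k + 1 differences, one beyond the range of
      \<open>unif0_seqs_orthogonal\<close>. As 1 is the coboundary of 1, their k-th difference is a
      constant r, that is, an element of \<open>Kfun T 0\<close>.\<close>
    have u: "unif0 (seqs (Suc k) T (\<lambda>_. 1) f)"
    proof (rule unif0_seqs_coboundary[OF B, where \<psi> = "\<lambda>_. 1"])
      fix r :: complex assume "norm r = 1"
      then have "(\<lambda>x. r) \<in> Kfun T 0" by auto
      from unif0_seqs_orthogonal[OF H2b f orth, of "k - 1" 0 1, OF _ _ this] assms(3)
      show "unif0 (seqs k T (\<lambda>x. r * 1) f)" by simp
    qed auto
    show "\<forall>x. (\<lambda>N. SUP P\<in>D. F x N P) \<longlonglongrightarrow> 0"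
    proof
      fix x
      show "(\<lambda>N. SUP P\<in>D. F x N P) \<longlonglongrightarrow> 0"
      proof (rule LIMSEQ_I)
        fix \<epsilon> :: real assume e0: "\<epsilon> > 0"
        obtain N0 where N0: "\<forall>N\<ge>N0. \<forall>a\<in>seqs (Suc k) T (\<lambda>_. 1) f. norm (sum a {..<N}) \<le> \<epsilon>/2 * real N"
          using u e0 unfolding unif0_def by (meson half_gt_zero)
        show "\<exists>no. \<forall>N\<ge>no. norm ((SUP P\<in>D. F x N P) - 0) < \<epsilon>"
        proof (intro exI[of _ "max 1 N0"] allI impI)
          fix N assume N: "max 1 N0 \<le> N"
          have "F x N P \<le> \<epsilon>/2" if "P \<in> D" for P
          proof -
            have "orb (Suc k) T (\<lambda>_. 1) x (e P)"
              unfolding orb_def using e1 poly_phase_dif_trivial[of P k] that unfolding D_def e_def[abs_def] by simp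
            then have "(\<lambda>n. e P n * f ((T ^^ n) x)) \<in> seqs (Suc k) T (\<lambda>_. 1) f"
              by (rule seqsI) simp
            then have "norm (\<Sum>n<N. e P n * f ((T ^^ n) x)) \<le> \<epsilon>/2 * real N" using N0 N by simp
            then show ?thesis using N unfolding F_def by (simp add: norm_mult norm_divide divide_simps mult.commute)
          qed
          then have "(SUP P\<in>D. F x N P) \<le> \<epsilon>/2" using D0 by (intro cSUP_least) auto
          moreover have "0 \<le> (SUP P\<in>D. F x N P)"
            using cSUP_upper[OF D0 bdd, of x N] F_nonneg[of x N 0] by linarith
          ultimately show "norm ((SUP P\<in>D. F x N P) - 0) < \<epsilon>" using e0 by simp
        qed
      qed
    qed
  next
    assume lim: "\<forall>x. (\<lambda>N. SUP P\<in>D. F x N P) \<longlonglongrightarrow> 0"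
    show "\<forall>g\<in>Gfun T k. (\<integral>x. f x * cnj (g x) \<partial>\<mu>) = 0"
    proof
      fix g assume "g \<in> Gfun T k"
      then have gK: "g \<in> Kfun T k" using Gfun_subset_Kfun[of T "k - 1"] assms(3) by auto
      note gc = Kfun_continuous[OF gK] and g1 = Kfun_norm[OF gK]
      define A where "A N x = (\<Sum>n<N. f ((T ^^ n) x) * cnj (g ((T ^^ n) x))) / of_nat N" for N :: nat and x
      have hc: "continuous_on UNIV (\<lambda>x. f x * cnj (g x))" by (intro continuous_intros f gc)
      have hc': "continuous_on UNIV (\<lambda>x. f ((T ^^ n) x) * cnj (g ((T ^^ n) x)))" for n
        using T.comp_Sn_cont[OF hc] .
      \<comment> \<open>Along the orbit of x the conjugate of g is itself a polynomial phase of
        degree at most k, so the average is one of the terms under the supremum.\<close>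
      have A_le: "norm (A N x) \<le> (SUP P\<in>D. F x N P)" for N x
      proof -
        define u where "u n = cnj (g ((T ^^ n) x))" for n
        obtain c where c: "norm c = 1" "\<And>n. (dif ^^ k) u n = c"
          using Kfun_dif_const[OF Kfun_cnj[OF gK], of x] unfolding u_def[abs_def] by blast
        have "(dif ^^ Suc k) u = (\<lambda>_. 1)"
          using c unimodular_mult_cnj[OF c(1)] by (simp add: dif_def fun_eq_iff)
        moreover have "norm (u n) = 1" for n unfolding u_def by (simp add: g1)
        ultimately obtain P where P: "degree P \<le> k" "\<And>n. u n = e P n"
          using dif_trivial_imp_poly_phase[of u k] unfolding e_def by blast
        have "norm (A N x) = F x N P"
          unfolding A_def F_def P(2)[symmetric] u_def by (simp add: mult.commute norm_divide norm_mult)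
        also have "\<dots> \<le> (SUP P\<in>D. F x N P)" using P(1) bdd by (intro cSUP_upper) (auto simp: D_def)
        finally show ?thesis .
      qed
      have A0: "(\<lambda>N. A N x) \<longlonglongrightarrow> 0" for x
        by (rule Lim_null_comparison[OF always_eventually lim[rule_format, of x]]) (simp add: A_le)
      have AB: "norm (A N x) \<le> B" for N x
        using A_le[of N x] cSUP_least[of D "F x N" B] D0 FB by fastforce
      have Am: "A N \<in> borel_measurable \<mu>" for N
        unfolding A_def[abs_def] using T.measurable_cont[OF hc']
        by (intro borel_measurable_divide borel_measurable_sum borel_measurable_const)
      \<comment> \<open>By invariance all \<open>A N\<close> with N \<ge> 1 have the same integral,
        so it must equal this limit.\<close>
      have "(\<lambda>N. \<integral>x. A N x \<partial>\<mu>) \<longlonglongrightarrow> (\<integral>x. 0 \<partial>\<mu>)"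
        by (rule integral_dominated_convergence[where w="\<lambda>_. B"]) (use A0 AB Am in auto)
      moreover have "(\<integral>x. A N x \<partial>\<mu>) = (\<integral>x. f x * cnj (g x) \<partial>\<mu>)" if "N \<ge> 1" for N
      proof -
        have "(\<integral>x. A N x \<partial>\<mu>) = (\<Sum>n<N. \<integral>x. f ((T ^^ n) x) * cnj (g ((T ^^ n) x)) \<partial>\<mu>) / of_nat N"
          unfolding A_def using T.integrable_cont[OF hc'] by simp
        also have "\<dots> = (\<Sum>n<N. \<integral>x. f x * cnj (g x) \<partial>\<mu>) / of_nat N"
          using T.integral_Sn[OF T.measurable_cont[OF hc]] by simp
        finally show ?thesis using that by simp
      qed
      then have "(\<lambda>N. \<integral>x. A N x \<partial>\<mu>) \<longlonglongrightarrow> (\<integral>x. f x * cnj (g x) \<partial>\<mu>)"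
        by (intro tendsto_eventually eventually_sequentiallyI[of 1])
      ultimately show "(\<integral>x. f x * cnj (g x) \<partial>\<mu>) = 0"
        using LIMSEQ_unique by fastforce
    qed
  qed
  then show ?thesis unfolding F_def D_def e_def .
qed

end
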